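(* Let $n\ge 2$, let $\xi=(\xi_i)_{1\le i\le n}$ be an exchangeable random vector with $\kappa=\mathbb{E}[|\xi_1|]\in(0,+\infty)$ and $\sum_{i=1}^n\xi_i=0$ almost surely. Let $(E,\mathcal{B})$ be a measurable space, let $\mathcal{T}$ be a (non-empty) set of measurable functions from $E$ to $[-1,1]$, and define $\overline{g}:E^n\to\mathbb{R}$ by $$\overline{g}(x)=\mathbb{E}\left[\sup_{t\in\mathcal{T}}\left\{\sum_{i=1}^n\xi_i t(x_i)\right\}\right],$$ the expectation being over $\xi$. Then the function $$\frac{\overline{g}}{\kappa\left(3-\frac2n\right)}:E^n\to\mathbb{R}$$ is $(2,0)$-self-bounding. As a consequence, if $X=(X_i)_{1\le i\le n}$ is a collection of $n$ independent $E$-valued random variables such that $\overline{g}(X)$ is measurable, then for any $x>0$, $$\overline{g}(X)\le \mathbb{E}[\overline{g}(X)]+\sqrt{12\kappa x\,\mathbb{E}[\overline{g}(X)]}+5\kappa x$$ with probability at least $1-e^{-x}$, and moreover $$\overline{g}(X)\ge \mathbb{E}[\overline{g}(X)]-\sqrt{12\kappa x\,\mathbb{E}[\overline{g}(X)]}$$ with probability at least $1-e^{-x}$.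
   Context: Exchangeable: the law of $(\xi_{\pi(1)},\dots,\xi_{\pi(n)})$ does not depend on the permutation $\pi$. Self-bounding: for a set $E$, an integer $n\ge1$ and $a,b\ge0$, a function $f:E^n\to\mathbb{R}$ (not necessarily measurable) is $(a,b)$-self-bounding if for all $i\in\{1,\dots,n\}$ there exists a function $f_i:E^{n-1}\to\mathbb{R}$ such that for all $x\in E^n$, $$0\le f(x)-f_i(x_{(i)})\le 1\ \text{ for every } i,\qquad \sum_{i=1}^n\bigl(f(x)-f_i(x_{(i)})\bigr)\le a f(x)+b,$$ where $x_{(i)}=(x_1,\dots,x_{i-1},x_{i+1},\dots,x_n)$.
   Formalization: The concentration bounds also assume that g-bar is measurable for the product sigma-algebra completed under the law of X; measurability of g-bar(X) alone is not enough, as the bounds can fail when X has a non-measurable range of full outer measure. *)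

theory Defs
  imports "HOL-Probability.Probability" "HOL-Combinatorics.Permutations"
begin

(* Vectors (x_1, ..., x_n) with entries in A are the elements of PiE {1..n} (\<lambda>_. A). *)

definition random_vector :: "nat \<Rightarrow> (nat \<Rightarrow> 'w \<Rightarrow> 'a) \<Rightarrow> 'w \<Rightarrow> (nat \<Rightarrow> 'a)" where
  "random_vector n X \<omega> = (\<lambda>i\<in>{1..n}. X i \<omega>)"

definition exchangeable :: "'w measure \<Rightarrow> nat \<Rightarrow> (nat \<Rightarrow> 'w \<Rightarrow> real) \<Rightarrow> bool" where
  "exchangeable M n \<xi> \<longleftrightarrow>
     (\<forall>\<pi>. \<pi> permutes {1..n} \<longrightarrow>
        distr M (Pi\<^sub>M {1..n} (\<lambda>_. borel)) (random_vector n (\<lambda>i. \<xi> (\<pi> i))) =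
        distr M (Pi\<^sub>M {1..n} (\<lambda>_. borel)) (random_vector n \<xi>))"

(* x_(i): the i-th coordinate is deleted and the later ones are shifted down,
   which gives a vector indexed by {1..n - 1}. *)
definition delete_coord :: "nat \<Rightarrow> nat \<Rightarrow> (nat \<Rightarrow> 'a) \<Rightarrow> (nat \<Rightarrow> 'a)" where
  "delete_coord n i x = (\<lambda>j\<in>{1..n - 1}. if j < i then x j else x (j + 1))"

definition self_bounding ::
    "'a set \<Rightarrow> nat \<Rightarrow> real \<Rightarrow> real \<Rightarrow> ((nat \<Rightarrow> 'a) \<Rightarrow> real) \<Rightarrow> bool" where
  "self_bounding A n a b f \<longleftrightarrow>
     (\<exists>F :: nat \<Rightarrow> (nat \<Rightarrow> 'a) \<Rightarrow> real.
        \<forall>x \<in> PiE {1..n} (\<lambda>_. A).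
          (\<forall>i\<in>{1..n}. 0 \<le> f x - F i (delete_coord n i x) \<and> f x - F i (delete_coord n i x) \<le> 1) \<and>
          (\<Sum>i=1..n. f x - F i (delete_coord n i x)) \<le> a * f x + b)"

(* For x with entries in the common domain of a non-empty class T of functions bounded by 1,
   the set under the supremum is non-empty and bounded by \<Sum>i. |\<xi>_i|, and the supremum is a
   continuous function of (\<xi>_1, ..., \<xi>_n).  So the integrand is measurable, and it is
   integrable as soon as the \<xi>_i are. *)
definition gbar ::
    "'w measure \<Rightarrow> nat \<Rightarrow> (nat \<Rightarrow> 'w \<Rightarrow> real) \<Rightarrow> ('a \<Rightarrow> real) set \<Rightarrow> (nat \<Rightarrow> 'a) \<Rightarrow> real" where
  "gbar M n \<xi> T x = (LINT \<omega>|M. (SUP t\<in>T. \<Sum>i=1..n. \<xi> i \<omega> * t (x i)))"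

(* f(X) is a measurable function of X = (X_1, ..., X_n): the composition is measurable on the
   underlying space N, and f itself is measurable for the product sigma-algebra completed under
   the law of X.  The second clause is not redundant: if the range of X is a non-measurable set
   of full outer measure, then f o X can be measurable on N (even for the sigma-algebra
   generated by X) although f is not measurable for the law of X, and the concentration
   inequalities can then fail.  Both clauses hold if f is measurable for the product
   sigma-algebra. *)
definition measurable_at ::
    "'v measure \<Rightarrow> 'a measure \<Rightarrow> nat \<Rightarrow> (nat \<Rightarrow> 'v \<Rightarrow> 'a) \<Rightarrow> ((nat \<Rightarrow> 'a) \<Rightarrow> real) \<Rightarrow> bool" where
  "measurable_at N E n X f \<longleftrightarrow>
     (\<lambda>\<omega>. f (random_vector n X \<omega>)) \<in> borel_measurable N \<and>
     f \<in> borel_measurable (completion (distr N (Pi\<^sub>M {1..n} (\<lambda>_. E)) (random_vector n X)))"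

end

theory Submission
  imports Defs
begin

text \<open>Averaging the weights over the transpositions $(i\,k)$, $k = 1, \dots, n$, produces weights
  that vanish at $i$, because the weights sum to zero.  By exchangeability and convexity of the
  supremum the corresponding expectation $\overline{g}_i$ is at most $\overline{g}$, and the
  averaged weights summed over $i$ are $(n-2)\xi$, which yields
  $\sum_i (\overline{g} - \overline{g}_i) \le 2 \overline{g}$.

  The tails come from the entropy method.  Tensorization of entropy gives, for
  $L(\lambda) = \ln \mathbb{E} e^{\lambda Z}$ with $Z$ self-bounding, the differential inequality
  $(\lambda - 2\varphi(-\lambda)) L' \le L$ with $\varphi(u) = e^u - u - 1$.  For
  $0 < \lambda < 1$ it makes $L(\lambda)(1/\lambda - 1)$ decreasing, so that
  $L(\lambda) \le \lambda \mathbb{E}Z / (1 - \lambda)$; for $\lambda = -s$ it makes $L(-s)/(s - s^2)$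
  decreasing on $(0,1)$, so that $L(-s) \le -(s - s^2)\mathbb{E}Z$.  Markov's inequality concludes.\<close>

section \<open>The supremum as a function of the weights\<close>

text \<open>Why transpositions: setting the i-th weight to zero breaks the zero sum, and since that
  weight is determined by the others, Jensen's inequality gives no comparison with
  \<open>gbar\<close>. A mean of permuted weights can be compared, because every permuted term has
  the same expectation. Measurability shapes the rest. The class may be uncountable, the functions
  f_i of the self-bounding property may be non-measurable, and f itself is measurable only for the
  completed law. So f is replaced by a bounded Borel version \<open>Z\<close>, and the f_i are never
  integrated: they only bound \<open>Z\<close> from below almost everywhere, which an essential
  infimum turns into a measurable lower bound. The factor 12 is 4 times 3: a deviation 2 sqrt(m x)
  of the function normalised by c = \<kappa> (3 - 2/n) becomes sqrt(4 c x EZ) after rescaling, and c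
  \<le> 3 \<kappa>.\<close>

definition sup_weighted :: "nat \<Rightarrow> ('e \<Rightarrow> real) set \<Rightarrow> (nat \<Rightarrow> 'e) \<Rightarrow> (nat \<Rightarrow> real) \<Rightarrow> real" where
  "sup_weighted n T x w = (SUP t\<in>T. \<Sum>i=1..n. w i * t (x i))"

text \<open>Only points carrying a nonzero weight matter. Since the i-th averaged weight is zero,
  this later allows the i-th point to be forgotten.\<close>

lemma sup_weighted_cong:
  assumes "\<And>i. i \<in> {1..n} \<Longrightarrow> w i = w' i"
    and "\<And>i. i \<in> {1..n} \<Longrightarrow> w i \<noteq> 0 \<Longrightarrow> x i = x' i"
  shows "sup_weighted n T x w = sup_weighted n T x' w'"
  unfolding sup_weighted_def
proof (rule SUP_cong[OF refl], rule sum.cong[OF refl])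
  fix t i assume "i \<in> {1..n}"
  then show "w i * t (x i) = w' i * t (x' i)"
    using assms[of i] by (cases "w i = 0") auto
qed

locale bounded_class =
  fixes n :: nat and T :: "('e \<Rightarrow> real) set" and x :: "nat \<Rightarrow> 'e"
  assumes T_nonempty: "T \<noteq> {}"
    and T_bounded: "\<And>t i. t \<in> T \<Longrightarrow> i \<in> {1..n} \<Longrightarrow> \<bar>t (x i)\<bar> \<le> 1"
begin

lemma abs_sum_le:
  assumes "t \<in> T"
  shows "\<bar>\<Sum>i=1..n. w i * t (x i)\<bar> \<le> (\<Sum>i=1..n. \<bar>w i\<bar>)"
proof -
  have "\<bar>\<Sum>i=1..n. w i * t (x i)\<bar> \<le> (\<Sum>i=1..n. \<bar>w i * t (x i)\<bar>)"
    by (rule sum_abs)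
  also have "\<dots> \<le> (\<Sum>i=1..n. \<bar>w i\<bar>)"
    using T_bounded[OF assms] by (intro sum_mono) (auto simp: abs_mult intro: mult_left_le)
  finally show ?thesis .
qed

lemma bdd: "bdd_above ((\<lambda>t. \<Sum>i=1..n. w i * t (x i)) ` T)"
  by (rule bdd_aboveI[where M = "\<Sum>i=1..n. \<bar>w i\<bar>"]) (use abs_sum_le[of _ w] in force)

lemma sup_upper: "t \<in> T \<Longrightarrow> (\<Sum>i=1..n. w i * t (x i)) \<le> sup_weighted n T x w"
  unfolding sup_weighted_def by (rule cSUP_upper[OF _ bdd])

lemma sup_least:
  "(\<And>t. t \<in> T \<Longrightarrow> (\<Sum>i=1..n. w i * t (x i)) \<le> c) \<Longrightarrow> sup_weighted n T x w \<le> c"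
  unfolding sup_weighted_def by (rule cSUP_least[OF T_nonempty])

lemma abs_sup_le: "\<bar>sup_weighted n T x w\<bar> \<le> (\<Sum>i=1..n. \<bar>w i\<bar>)"
proof -
  obtain t where t: "t \<in> T" using T_nonempty by auto
  have "sup_weighted n T x w \<le> (\<Sum>i=1..n. \<bar>w i\<bar>)"
    by (rule sup_least) (use abs_sum_le[of _ w] in force)
  moreover have "- (\<Sum>i=1..n. \<bar>w i\<bar>) \<le> sup_weighted n T x w"
    using abs_sum_le[OF t, of w] sup_upper[OF t, of w] by linarith
  ultimately show ?thesis by linarith
qed

lemma sup_add_le:
  "sup_weighted n T x (\<lambda>i. u i + v i) \<le> sup_weighted n T x u + sup_weighted n T x v"
proof (rule sup_least)
  fix t assume "t \<in> T"
  then show "(\<Sum>i=1..n. (u i + v i) * t (x i)) \<le> sup_weighted n T x u + sup_weighted n T x v"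
    unfolding distrib_right sum.distrib by (intro add_mono sup_upper)
qed

lemma sup_zero: "sup_weighted n T x (\<lambda>i. 0) = 0"
  using abs_sup_le[of "\<lambda>i. 0"] by simp

lemma sup_sum_le:
  "finite K \<Longrightarrow>
    sup_weighted n T x (\<lambda>i. \<Sum>k\<in>K. u k i) \<le> (\<Sum>k\<in>K. sup_weighted n T x (u k))"
proof (induction K rule: finite_induct)
  case empty
  then show ?case by (simp add: sup_zero)
next
  case (insert k K)
  then show ?case
    using sup_add_le[of "u k" "\<lambda>i. \<Sum>k\<in>K. u k i"] by simp
qed

lemma sup_scale_le:
  assumes "0 \<le> c"
  shows "sup_weighted n T x (\<lambda>i. c * u i) \<le> c * sup_weighted n T x u"
proof (rule sup_least)
  fix t assume "t \<in> T"
  have "(\<Sum>i=1..n. c * u i * t (x i)) = c * (\<Sum>i=1..n. u i * t (x i))"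
    by (simp add: sum_distrib_left mult.assoc)
  also have "\<dots> \<le> c * sup_weighted n T x u"
    by (rule mult_left_mono[OF sup_upper[OF \<open>t \<in> T\<close>] assms])
  finally show "(\<Sum>i=1..n. c * u i * t (x i)) \<le> c * sup_weighted n T x u" .
qed

lemma sup_scale:
  assumes "0 \<le> c"
  shows "sup_weighted n T x (\<lambda>i. c * u i) = c * sup_weighted n T x u"
proof (cases "c = 0")
  case True
  then show ?thesis by (simp add: sup_zero)
next
  case False
  then have c: "0 < c" using assms by simp
  have "sup_weighted n T x (\<lambda>i. inverse c * (c * u i))
      \<le> inverse c * sup_weighted n T x (\<lambda>i. c * u i)"
    using c by (intro sup_scale_le) simp
  then have "c * sup_weighted n T x u \<le> sup_weighted n T x (\<lambda>i. c * u i)"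
    using c by (simp add: field_simps)
  then show ?thesis using sup_scale_le[OF assms, of u] by linarith
qed

lemma sup_diff_le:
  "sup_weighted n T x u - sup_weighted n T x v \<le> (\<Sum>i=1..n. \<bar>u i - v i\<bar>)"
  using sup_add_le[of "\<lambda>i. u i - v i" v] abs_sup_le[of "\<lambda>i. u i - v i"] by simp

text \<open>A supremum over an uncountable class is measurable here through continuity: by
  \<open>sup_diff_le\<close> it is 1-Lipschitz for the l1 distance of the weights.\<close>

lemma sup_measurable_PiM [measurable]:
  "sup_weighted n T x \<in> borel_measurable (Pi\<^sub>M {1..n} (\<lambda>_. borel))"
proof -
  let ?h = "sup_weighted n T x"
  have "continuous_on UNIV ?h"
    unfolding continuous_on
  proof
    fix u :: "nat \<Rightarrow> real"
    have "continuous_on UNIV (\<lambda>v :: nat \<Rightarrow> real. \<Sum>i=1..n. \<bar>v i - u i\<bar>)"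
      by (intro continuous_on_sum continuous_on_rabs continuous_on_diff continuous_on_const
          continuous_on_product_coordinates)
    then have "((\<lambda>v. \<Sum>i=1..n. \<bar>v i - u i\<bar>) \<longlongrightarrow> (\<Sum>i=1..n. \<bar>u i - u i\<bar>)) (at u)"
      unfolding continuous_on by blast
    then have lim: "((\<lambda>v. \<Sum>i=1..n. \<bar>v i - u i\<bar>) \<longlongrightarrow> 0) (at u)"
      by simp
    have "((\<lambda>v. ?h v - ?h u) \<longlongrightarrow> 0) (at u)"
    proof (rule tendsto_0_le[OF lim, where K = 1], rule always_eventually, rule allI)
      fix v
      have "(\<Sum>i=1..n. \<bar>v i - u i\<bar>) = (\<Sum>i=1..n. \<bar>u i - v i\<bar>)"
        by (intro sum.cong) auto
      then show "norm (?h v - ?h u) \<le> norm (\<Sum>i=1..n. \<bar>v i - u i\<bar>) * 1"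
        using sup_diff_le[of u v] sup_diff_le[of v u] by auto
    qed
    then show "(?h \<longlongrightarrow> ?h u) (at u within UNIV)"
      by (simp add: LIM_zero_iff)
  qed
  then have h: "?h \<in> borel_measurable borel"
    by (rule borel_measurable_continuous_onI)
  \<comment> \<open>Continuity was shown on the full space \<open>nat \<Rightarrow> real\<close>;
    extending by 0 outside {1..n}, which leaves the supremum unchanged, carries it to the finite
    product.\<close>
  have e: "(\<lambda>w i. if i \<in> {1..n} then w i else 0) \<in> Pi\<^sub>M {1..n} (\<lambda>_. borel) \<rightarrow>\<^sub>M (borel :: (nat \<Rightarrow> real) measure)"
  proof (rule measurable_coordinatewise_then_product)
    show "(\<lambda>w. if i \<in> {1..n} then w i else 0) \<in> borel_measurable (Pi\<^sub>M {1..n} (\<lambda>_. borel))"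
      for i
      by (cases "i \<in> {1..n}") (auto simp del: atLeastAtMost_iff)
  qed
  have "?h = (\<lambda>w. ?h (\<lambda>i. if i \<in> {1..n} then w i else 0))"
    by (rule ext, rule sup_weighted_cong) auto
  then show ?thesis
    using measurable_compose[OF e h] by simp
qed

lemma sup_measurable [measurable (raw)]:
  assumes "\<And>i. i \<in> {1..n} \<Longrightarrow> (\<lambda>\<omega>. W \<omega> i) \<in> borel_measurable M"
  shows "(\<lambda>\<omega>. sup_weighted n T x (W \<omega>)) \<in> borel_measurable M"
proof -
  have "(\<lambda>\<omega>. \<lambda>i\<in>{1..n}. W \<omega> i) \<in> M \<rightarrow>\<^sub>M Pi\<^sub>M {1..n} (\<lambda>_. borel)"
    using assms by (intro measurable_restrict) auto
  from measurable_compose[OF this sup_measurable_PiM] show ?thesis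
    by (rule measurable_cong[THEN iffD1, rotated]) (auto intro: sup_weighted_cong)
qed

lemma sup_integrable:
  assumes "\<And>i. i \<in> {1..n} \<Longrightarrow> integrable M (\<lambda>\<omega>. W \<omega> i)"
  shows "integrable M (\<lambda>\<omega>. sup_weighted n T x (W \<omega>))"
proof (rule Bochner_Integration.integrable_bound)
  show "integrable M (\<lambda>\<omega>. \<Sum>i=1..n. \<bar>W \<omega> i\<bar>)"
    using assms by auto
  show "AE \<omega> in M. norm (sup_weighted n T x (W \<omega>)) \<le> norm (\<Sum>i=1..n. \<bar>W \<omega> i\<bar>)"
    using abs_sup_le by (auto simp: sum_nonneg)
qed (use assms in \<open>auto intro!: sup_measurable\<close>)

end

section \<open>Exchangeable weights\<close>

lemma exchangeable_integral:
  fixes h :: "(nat \<Rightarrow> real) \<Rightarrow> real"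
  assumes ex: "exchangeable M n \<xi>" and p: "\<pi> permutes {1..n}"
    and meas: "\<And>i. i \<in> {1..n} \<Longrightarrow> \<xi> i \<in> borel_measurable M"
    and h: "h \<in> borel_measurable (Pi\<^sub>M {1..n} (\<lambda>_. borel))"
  shows "integrable M (\<lambda>\<omega>. h (random_vector n (\<lambda>i. \<xi> (\<pi> i)) \<omega>)) \<longleftrightarrow>
      integrable M (\<lambda>\<omega>. h (random_vector n \<xi> \<omega>))"
    and "(LINT \<omega>|M. h (random_vector n (\<lambda>i. \<xi> (\<pi> i)) \<omega>)) = (LINT \<omega>|M. h (random_vector n \<xi> \<omega>))"
proof -
  have m1: "random_vector n \<xi> \<in> M \<rightarrow>\<^sub>M Pi\<^sub>M {1..n} (\<lambda>_. borel)"
    unfolding random_vector_def using meas by (intro measurable_restrict) auto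
  have m2: "random_vector n (\<lambda>i. \<xi> (\<pi> i)) \<in> M \<rightarrow>\<^sub>M Pi\<^sub>M {1..n} (\<lambda>_. borel)"
    unfolding random_vector_def
    using meas permutes_in_image[OF p] by (intro measurable_restrict) auto
  have eq: "distr M (Pi\<^sub>M {1..n} (\<lambda>_. borel)) (random_vector n (\<lambda>i. \<xi> (\<pi> i))) =
      distr M (Pi\<^sub>M {1..n} (\<lambda>_. borel)) (random_vector n \<xi>)"
    using ex p unfolding exchangeable_def by blast
  show "integrable M (\<lambda>\<omega>. h (random_vector n (\<lambda>i. \<xi> (\<pi> i)) \<omega>)) \<longleftrightarrow>
      integrable M (\<lambda>\<omega>. h (random_vector n \<xi> \<omega>))"
    using integrable_distr_eq[OF m1 h] integrable_distr_eq[OF m2 h] eq by simp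
  show "(LINT \<omega>|M. h (random_vector n (\<lambda>i. \<xi> (\<pi> i)) \<omega>)) = (LINT \<omega>|M. h (random_vector n \<xi> \<omega>))"
    using integral_distr[OF m1 h] integral_distr[OF m2 h] eq by simp
qed

locale exchangeable_weights = prob_space M for M :: "'w measure" +
  fixes n :: nat and \<xi> :: "nat \<Rightarrow> 'w \<Rightarrow> real" and \<kappa> :: real
  assumes n_ge: "2 \<le> n"
    and \<xi>_measurable: "\<And>i. i \<in> {1..n} \<Longrightarrow> \<xi> i \<in> borel_measurable M"
    and exch: "exchangeable M n \<xi>"
    and \<xi>_1_integrable: "integrable M (\<lambda>\<omega>. \<bar>\<xi> 1 \<omega>\<bar>)"
    and \<kappa>_eq: "\<kappa> = (LINT \<omega>|M. \<bar>\<xi> 1 \<omega>\<bar>)"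
    and \<kappa>_pos: "0 < \<kappa>"
    and \<xi>_sum: "AE \<omega> in M. (\<Sum>i=1..n. \<xi> i \<omega>) = 0"
begin

lemma \<xi>_abs:
  assumes i: "i \<in> {1..n}"
  shows "integrable M (\<lambda>\<omega>. \<bar>\<xi> i \<omega>\<bar>)" "(LINT \<omega>|M. \<bar>\<xi> i \<omega>\<bar>) = \<kappa>"
proof -
  have p: "Transposition.transpose 1 i permutes {1..n}"
    using i n_ge by (intro permutes_swap_id) auto
  have h: "(\<lambda>w. \<bar>w 1\<bar>) \<in> borel_measurable (Pi\<^sub>M {1..n} (\<lambda>_. borel :: real measure))"
    using n_ge by (intro borel_measurable_abs measurable_component_singleton) auto
  have "random_vector n (\<lambda>j. \<xi> (Transposition.transpose 1 i j)) \<omega> 1 = \<xi> i \<omega>" "random_vector n \<xi> \<omega> 1 = \<xi> 1 \<omega>"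
    for \<omega>
    using n_ge by (auto simp: random_vector_def)
  with exchangeable_integral[OF exch p \<xi>_measurable h] \<xi>_1_integrable \<kappa>_eq
  show "integrable M (\<lambda>\<omega>. \<bar>\<xi> i \<omega>\<bar>)" "(LINT \<omega>|M. \<bar>\<xi> i \<omega>\<bar>) = \<kappa>"
    by auto
qed

lemma \<xi>_integrable: "i \<in> {1..n} \<Longrightarrow> integrable M (\<xi> i)"
  using \<xi>_abs(1) \<xi>_measurable integrable_abs_iff by blast

lemma gbar_eq: "gbar M n \<xi> T x = (LINT \<omega>|M. sup_weighted n T x (\<lambda>i. \<xi> i \<omega>))"
  by (simp add: gbar_def sup_weighted_def)

lemma integral_sup_permute:
  assumes "bounded_class n T x" and p: "\<pi> permutes {1..n}"
  shows "(LINT \<omega>|M. sup_weighted n T x (\<lambda>j. \<xi> (\<pi> j) \<omega>)) = gbar M n \<xi> T x"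
proof -
  interpret bounded_class n T x by fact
  have "sup_weighted n T x (random_vector n \<zeta> \<omega>) = sup_weighted n T x (\<lambda>j. \<zeta> j \<omega>)"
    for \<zeta> :: "nat \<Rightarrow> 'w \<Rightarrow> real" and \<omega>
    by (rule sup_weighted_cong) (auto simp: random_vector_def)
  with exchangeable_integral(2)[OF exch p \<xi>_measurable sup_measurable_PiM]
  show ?thesis by (simp add: gbar_eq)
qed

text \<open>Averaging $\xi$ over the $n$ transpositions $(i\,k)$, $k = 1, \dots, n$, kills the $i$-th
  weight because the weights sum to zero; this makes the averaged supremum independent of the
  $i$-th point.\<close>

definition averaged :: "nat \<Rightarrow> 'w \<Rightarrow> nat \<Rightarrow> real" where
  "averaged i \<omega> j = (if j = i then 0 else ((real n - 1) * \<xi> j \<omega> + \<xi> i \<omega>) / real n)"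

text \<open>For j = i the transpositions run through all the weights, whose sum vanishes. For j
  different from i, (i k) moves j only when k = j, giving one \<open>\<xi> i\<close>; the other n -
  1 terms are \<open>\<xi> j\<close>.\<close>

lemma averaged_eq_transpositions:
  assumes i: "i \<in> {1..n}" and j: "j \<in> {1..n}" and s: "(\<Sum>i=1..n. \<xi> i \<omega>) = 0"
  shows "averaged i \<omega> j = (\<Sum>k=1..n. (1 / real n) * \<xi> (Transposition.transpose i k j) \<omega>)"
proof (cases "j = i")
  case True
  have "(\<Sum>k=1..n. (1 / real n) * \<xi> (Transposition.transpose i k j) \<omega>)
      = (1 / real n) * (\<Sum>k=1..n. \<xi> k \<omega>)"
    by (simp only: True transpose_apply_first sum_distrib_left)
  then show ?thesis
    using s True by (simp add: averaged_def)
next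
  case False
  have "(\<Sum>k=1..n. \<xi> (Transposition.transpose i k j) \<omega>)
      = \<xi> (Transposition.transpose i j j) \<omega> + (\<Sum>k\<in>{1..n} - {j}. \<xi> (Transposition.transpose i k j) \<omega>)"
    using j by (simp add: sum.remove)
  also have "(\<Sum>k\<in>{1..n} - {j}. \<xi> (Transposition.transpose i k j) \<omega>) = (\<Sum>k\<in>{1..n} - {j}. \<xi> j \<omega>)"
    using False by (intro sum.cong) (auto simp: Transposition.transpose_def)
  also have "\<dots> = (real n - 1) * \<xi> j \<omega>"
    using j n_ge by (simp add: of_nat_diff)
  finally show ?thesis
    using False by (simp add: averaged_def sum_divide_distrib[symmetric])
qed

text \<open>The n - 1 indices i different from j give (n-1)^2 copies of \<open>\<xi> j\<close> plus
  the remaining weights, which add up to minus \<open>\<xi> j\<close>; the factor is ((n-1)^2 - 1)/n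
  = n - 2.\<close>

lemma sum_averaged:
  assumes j: "j \<in> {1..n}" and s: "(\<Sum>i=1..n. \<xi> i \<omega>) = 0"
  shows "(\<Sum>i=1..n. averaged i \<omega> j) = (real n - 2) * \<xi> j \<omega>"
proof -
  have "(\<Sum>i=1..n. averaged i \<omega> j) = (\<Sum>i\<in>{1..n}-{j}. averaged i \<omega> j)"
    using j by (simp add: sum.remove averaged_def)
  also have "\<dots> = (\<Sum>i\<in>{1..n}-{j}. ((real n - 1) * \<xi> j \<omega> + \<xi> i \<omega>) / real n)"
    by (intro sum.cong) (auto simp: averaged_def)
  also have "\<dots> = ((\<Sum>i\<in>{1..n}-{j}. (real n - 1) * \<xi> j \<omega>) + (\<Sum>i\<in>{1..n}-{j}. \<xi> i \<omega>)) / real n"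
    by (simp only: sum_divide_distrib[symmetric] sum.distrib)
  also have "(\<Sum>i\<in>{1..n}-{j}. (real n - 1) * \<xi> j \<omega>) = (real n - 1) * (real n - 1) * \<xi> j \<omega>"
    using j n_ge by (simp add: of_nat_diff)
  also have "(\<Sum>i\<in>{1..n}-{j}. \<xi> i \<omega>) = - \<xi> j \<omega>"
    using s j by (simp add: sum.remove)
  also have "((real n - 1) * (real n - 1) * \<xi> j \<omega> + - \<xi> j \<omega>) / real n = (real n - 2) * \<xi> j \<omega>"
    using n_ge by (simp add: field_simps)
  finally show ?thesis .
qed

lemma averaged_integrable:
  assumes "i \<in> {1..n}" "j \<in> {1..n}"
  shows "integrable M (\<lambda>\<omega>. averaged i \<omega> j)"
  unfolding averaged_def using assms \<xi>_integrable by (cases "j = i") auto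

text \<open>Kept as a function of the full vector, so that it is compared with \<open>gbar\<close>
  at the same point; that it ignores the i-th point is brought in only in
  \<open>gbar_self_bounding\<close>.\<close>

definition gbar_del :: "('e \<Rightarrow> real) set \<Rightarrow> (nat \<Rightarrow> 'e) \<Rightarrow> nat \<Rightarrow> real" where
  "gbar_del T x i = (LINT \<omega>|M. sup_weighted n T x (averaged i \<omega>))"

lemma gbar_del_le:
  assumes "bounded_class n T x" and i: "i \<in> {1..n}"
  shows "gbar_del T x i \<le> gbar M n \<xi> T x"
proof -
  interpret bounded_class n T x by fact
  have p: "Transposition.transpose i k permutes {1..n}" if "k \<in> {1..n}" for k
    using i that by (intro permutes_swap_id) auto
  have tr: "Transposition.transpose i k j \<in> {1..n}" if "k \<in> {1..n}" "j \<in> {1..n}" for k j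
    using permutes_in_image[OF p] that by blast
  have int: "integrable M (\<lambda>\<omega>. sup_weighted n T x (\<lambda>j. \<xi> (Transposition.transpose i k j) \<omega>))"
    if "k \<in> {1..n}" for k
    using tr that by (intro sup_integrable \<xi>_integrable) auto
  have "gbar_del T x i
      \<le> (LINT \<omega>|M. (\<Sum>k=1..n. (1 / real n) * sup_weighted n T x (\<lambda>j. \<xi> (Transposition.transpose i k j) \<omega>)))"
    unfolding gbar_del_def
  \<comment> \<open>The averaged weights are a mean of permuted weights only where the weights sum
    to zero, hence only almost surely.\<close>
  proof (rule integral_mono_AE)
    show "AE \<omega> in M. sup_weighted n T x (averaged i \<omega>)
        \<le> (\<Sum>k=1..n. (1 / real n) * sup_weighted n T x (\<lambda>j. \<xi> (Transposition.transpose i k j) \<omega>))"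
      using \<xi>_sum
    proof eventually_elim
      case (elim \<omega>)
      have "sup_weighted n T x (averaged i \<omega>)
          = sup_weighted n T x (\<lambda>j. \<Sum>k=1..n. (1 / real n) * \<xi> (Transposition.transpose i k j) \<omega>)"
        using averaged_eq_transpositions[OF i _ elim] by (intro sup_weighted_cong) auto
      also have "\<dots> \<le> (\<Sum>k=1..n. sup_weighted n T x (\<lambda>j. (1 / real n) * \<xi> (Transposition.transpose i k j) \<omega>))"
        by (rule sup_sum_le) simp
      also have "\<dots> = (\<Sum>k=1..n. (1 / real n) * sup_weighted n T x (\<lambda>j. \<xi> (Transposition.transpose i k j) \<omega>))"
        by (intro sum.cong refl sup_scale) simp
      finally show ?case .
    qed
  qed (use int averaged_integrable[OF i] in
      \<open>auto intro!: sup_integrable Bochner_Integration.integrable_sum\<close>)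
  also have "\<dots> = (\<Sum>k=1..n. (1 / real n) * gbar M n \<xi> T x)"
  proof (subst Bochner_Integration.integral_sum)
    show "integrable M (\<lambda>\<omega>. (1 / real n) * sup_weighted n T x (\<lambda>j. \<xi> (Transposition.transpose i k j) \<omega>))"
      if "k \<in> {1..n}" for k
      using int[OF that] by auto
    show "(\<Sum>k=1..n. LINT \<omega>|M. (1 / real n) * sup_weighted n T x (\<lambda>j. \<xi> (Transposition.transpose i k j) \<omega>))
        = (\<Sum>k=1..n. (1 / real n) * gbar M n \<xi> T x)"
      using integral_sup_permute[OF assms(1) p] by (intro sum.cong) auto
  qed
  also have "\<dots> = gbar M n \<xi> T x"
    using n_ge by simp
  finally show ?thesis .
qed

text \<open>The supremum is 1-Lipschitz in l1. Coordinate i moves by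
  \<open>\<bar>\<xi> i \<omega>\<bar>\<close> and each other coordinate j by at most (|\<xi>_j| +
  |\<xi>_i|)/n, so the expected distance is at most \<kappa> + (n-1) 2\<kappa>/n, the normalising
  constant.\<close>

lemma gbar_diff_le:
  assumes "bounded_class n T x" and i: "i \<in> {1..n}"
  shows "gbar M n \<xi> T x - gbar_del T x i \<le> \<kappa> * (3 - 2 / real n)"
proof -
  interpret bounded_class n T x by fact
  let ?B = "\<lambda>\<omega>. \<bar>\<xi> i \<omega>\<bar> + (\<Sum>j\<in>{1..n}-{i}. (1 / real n) * (\<bar>\<xi> j \<omega>\<bar> + \<bar>\<xi> i \<omega>\<bar>))"
  have int: "integrable M (\<lambda>\<omega>. sup_weighted n T x (\<lambda>j. \<xi> j \<omega>))"
    "integrable M (\<lambda>\<omega>. sup_weighted n T x (averaged i \<omega>))"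
    using \<xi>_integrable averaged_integrable[OF i] by (auto intro!: sup_integrable)
  have intB: "integrable M ?B"
    using \<xi>_abs(1) i
    by (intro Bochner_Integration.integrable_add Bochner_Integration.integrable_sum
        integrable_mult_right) auto
  have "gbar M n \<xi> T x - gbar_del T x i
      = (LINT \<omega>|M. sup_weighted n T x (\<lambda>j. \<xi> j \<omega>) - sup_weighted n T x (averaged i \<omega>))"
    unfolding gbar_eq gbar_del_def using int by simp
  also have "\<dots> \<le> (LINT \<omega>|M. ?B \<omega>)"
  proof (rule integral_mono)
    fix \<omega>
    have "sup_weighted n T x (\<lambda>j. \<xi> j \<omega>) - sup_weighted n T x (averaged i \<omega>)
        \<le> (\<Sum>j=1..n. \<bar>\<xi> j \<omega> - averaged i \<omega> j\<bar>)"
      by (rule sup_diff_le)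
    also have "\<dots> = \<bar>\<xi> i \<omega>\<bar> + (\<Sum>j\<in>{1..n}-{i}. \<bar>\<xi> j \<omega> - averaged i \<omega> j\<bar>)"
      using i by (simp add: sum.remove averaged_def)
    also have "(\<Sum>j\<in>{1..n}-{i}. \<bar>\<xi> j \<omega> - averaged i \<omega> j\<bar>)
        \<le> (\<Sum>j\<in>{1..n}-{i}. (1 / real n) * (\<bar>\<xi> j \<omega>\<bar> + \<bar>\<xi> i \<omega>\<bar>))"
    proof (rule sum_mono)
      fix j assume "j \<in> {1..n} - {i}"
      then have "\<xi> j \<omega> - averaged i \<omega> j = (1 / real n) * (\<xi> j \<omega> - \<xi> i \<omega>)"
        using n_ge by (simp add: averaged_def field_simps)
      then have "\<bar>\<xi> j \<omega> - averaged i \<omega> j\<bar> = (1 / real n) * \<bar>\<xi> j \<omega> - \<xi> i \<omega>\<bar>"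
        by (simp add: abs_mult)
      also have "\<dots> \<le> (1 / real n) * (\<bar>\<xi> j \<omega>\<bar> + \<bar>\<xi> i \<omega>\<bar>)"
        by (rule mult_left_mono) (auto intro: abs_triangle_ineq4)
      finally show "\<bar>\<xi> j \<omega> - averaged i \<omega> j\<bar> \<le> (1 / real n) * (\<bar>\<xi> j \<omega>\<bar> + \<bar>\<xi> i \<omega>\<bar>)" .
    qed
    finally show "sup_weighted n T x (\<lambda>j. \<xi> j \<omega>) - sup_weighted n T x (averaged i \<omega>) \<le> ?B \<omega>"
      by simp
  qed (use int intB in auto)
  also have "\<dots> = \<kappa> + (LINT \<omega>|M. (\<Sum>j\<in>{1..n}-{i}. (1 / real n) * (\<bar>\<xi> j \<omega>\<bar> + \<bar>\<xi> i \<omega>\<bar>)))"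
    using \<xi>_abs i by (subst Bochner_Integration.integral_add) auto
  also have "(LINT \<omega>|M. (\<Sum>j\<in>{1..n}-{i}. (1 / real n) * (\<bar>\<xi> j \<omega>\<bar> + \<bar>\<xi> i \<omega>\<bar>)))
      = (\<Sum>j\<in>{1..n}-{i}. (LINT \<omega>|M. (1 / real n) * (\<bar>\<xi> j \<omega>\<bar> + \<bar>\<xi> i \<omega>\<bar>)))"
    using \<xi>_abs(1) i by (intro Bochner_Integration.integral_sum integrable_mult_right) auto
  also have "\<dots> = (\<Sum>j\<in>{1..n}-{i}. (1 / real n) * (\<kappa> + \<kappa>))"
    using \<xi>_abs i by (intro sum.cong) auto
  also have "\<kappa> + \<dots> = \<kappa> * (3 - 2 / real n)"
  proof -
    have "(\<Sum>j\<in>{1..n}-{i}. (1 / real n) * (\<kappa> + \<kappa>)) = (real n - 1) * ((1 / real n) * (\<kappa> + \<kappa>))"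
      using i n_ge by (simp add: of_nat_diff)
    then show ?thesis
      using n_ge by (simp add: field_simps)
  qed
  finally show ?thesis .
qed

text \<open>Subadditivity bounds the sum of the averaged suprema below by (n-2) times the original
  one, leaving n - (n-2) = 2. Homogeneity applies because n - 2 is nonnegative.\<close>

lemma sum_gbar_diff_le:
  assumes "bounded_class n T x"
  shows "(\<Sum>i=1..n. gbar M n \<xi> T x - gbar_del T x i) \<le> 2 * gbar M n \<xi> T x"
proof -
  interpret bounded_class n T x by fact
  have int: "integrable M (\<lambda>\<omega>. sup_weighted n T x (averaged i \<omega>))" if "i \<in> {1..n}" for i
    using averaged_integrable that by (auto intro!: sup_integrable)
  have "(real n - 2) * gbar M n \<xi> T x
      = (LINT \<omega>|M. (real n - 2) * sup_weighted n T x (\<lambda>j. \<xi> j \<omega>))"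
    unfolding gbar_eq by simp
  also have "\<dots> \<le> (LINT \<omega>|M. (\<Sum>i=1..n. sup_weighted n T x (averaged i \<omega>)))"
  proof (rule integral_mono_AE)
    show "AE \<omega> in M. (real n - 2) * sup_weighted n T x (\<lambda>j. \<xi> j \<omega>)
        \<le> (\<Sum>i=1..n. sup_weighted n T x (averaged i \<omega>))"
      using \<xi>_sum
    proof eventually_elim
      case (elim \<omega>)
      have "(real n - 2) * sup_weighted n T x (\<lambda>j. \<xi> j \<omega>)
          = sup_weighted n T x (\<lambda>j. (real n - 2) * \<xi> j \<omega>)"
        using n_ge by (intro sup_scale[symmetric]) simp
      also have "\<dots> = sup_weighted n T x (\<lambda>j. \<Sum>i=1..n. averaged i \<omega> j)"
        using sum_averaged[OF _ elim] by (intro sup_weighted_cong) auto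
      also have "\<dots> \<le> (\<Sum>i=1..n. sup_weighted n T x (averaged i \<omega>))"
        by (rule sup_sum_le) simp
      finally show ?case .
    qed
    show "integrable M (\<lambda>\<omega>. \<Sum>i=1..n. sup_weighted n T x (averaged i \<omega>))"
      using int by (rule Bochner_Integration.integrable_sum)
  qed (use \<xi>_integrable in \<open>auto intro!: sup_integrable\<close>)
  also have "\<dots> = (\<Sum>i=1..n. gbar_del T x i)"
    unfolding gbar_del_def using int by (intro Bochner_Integration.integral_sum) auto
  finally show ?thesis
    by (simp add: sum_subtractf algebra_simps)
qed

text \<open>A bound uniform in \<open>x\<close>, which makes every exponential moment in the entropy
  method finite.\<close>

lemma gbar_abs_le:
  assumes "bounded_class n T x"
  shows "\<bar>gbar M n \<xi> T x\<bar> \<le> real n * \<kappa>"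
proof -
  interpret bounded_class n T x by fact
  have "\<bar>gbar M n \<xi> T x\<bar> \<le> (LINT \<omega>|M. \<bar>sup_weighted n T x (\<lambda>i. \<xi> i \<omega>)\<bar>)"
    unfolding gbar_eq by (rule integral_abs_bound)
  also have "\<dots> \<le> (LINT \<omega>|M. (\<Sum>i=1..n. \<bar>\<xi> i \<omega>\<bar>))"
    using \<xi>_integrable \<xi>_abs abs_sup_le by (intro integral_mono) (auto intro!: sup_integrable integrable_abs)
  also have "\<dots> = real n * \<kappa>"
    using \<xi>_abs by simp
  finally show ?thesis .
qed

lemma scale_pos: "0 < \<kappa> * (3 - 2 / real n)"
  using \<kappa>_pos n_ge by (intro mult_pos_pos) (auto simp: field_simps)

lemma gbar_self_bounding:
  fixes A :: "'e set"
  assumes ne: "T \<noteq> {}" and bd: "\<And>t y. t \<in> T \<Longrightarrow> y \<in> A \<Longrightarrow> \<bar>t y\<bar> \<le> 1"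
  shows "self_bounding A n 2 0 (\<lambda>x. gbar M n \<xi> T x / (\<kappa> * (3 - 2 / real n)))"
  unfolding self_bounding_def
proof (intro exI ballI)
  let ?c = "\<kappa> * (3 - 2 / real n)"
  \<comment> \<open>Reinserts a coordinate at position i. Its value \<open>y (i - 1)\<close> is
    arbitrary (even outside the index set when i = 1) and harmless, since the weight there is
    zero.\<close>
  let ?ins = "\<lambda>i y j. if j < i then y j else y (j - 1)"
  let ?F = "\<lambda>i y. gbar_del T (?ins i y) i / ?c"
  fix x :: "nat \<Rightarrow> 'e" assume x: "x \<in> PiE {1..n} (\<lambda>_. A)"
  interpret bounded_class n T x
  proof
    show "\<bar>t (x i)\<bar> \<le> 1" if "t \<in> T" "i \<in> {1..n}" for t i
      using bd[OF that(1)] PiE_mem[OF x that(2)] by blast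
  qed fact
  have bc: "bounded_class n T x" ..
  have F: "?F i (delete_coord n i x) = gbar_del T x i / ?c" if i: "i \<in> {1..n}" for i
  proof -
    have "sup_weighted n T (?ins i (delete_coord n i x)) (averaged i \<omega>)
        = sup_weighted n T x (averaged i \<omega>)" for \<omega>
    proof (rule sup_weighted_cong[OF refl])
      fix j assume j: "j \<in> {1..n}" and "averaged i \<omega> j \<noteq> 0"
      then have "j \<noteq> i" by (auto simp: averaged_def)
      with i j show "?ins i (delete_coord n i x) j = x j"
        by (auto simp: delete_coord_def)
    qed
    then show ?thesis by (simp add: gbar_del_def)
  qed
  note c = scale_pos
  have "(\<Sum>i=1..n. gbar M n \<xi> T x / ?c - ?F i (delete_coord n i x))
      = (\<Sum>i=1..n. gbar M n \<xi> T x - gbar_del T x i) / ?c"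
    unfolding sum_divide_distrib by (intro sum.cong) (auto simp only: F diff_divide_distrib)
  also have "\<dots> \<le> 2 * gbar M n \<xi> T x / ?c"
    using sum_gbar_diff_le[OF bc] c by (intro divide_right_mono) auto
  finally have s: "(\<Sum>i=1..n. gbar M n \<xi> T x / ?c - ?F i (delete_coord n i x))
      \<le> 2 * (gbar M n \<xi> T x / ?c) + 0" by simp
  have b: "0 \<le> gbar M n \<xi> T x / ?c - ?F i (delete_coord n i x) \<and>
      gbar M n \<xi> T x / ?c - ?F i (delete_coord n i x) \<le> 1" if i: "i \<in> {1..n}" for i
    using gbar_del_le[OF bc i] gbar_diff_le[OF bc i] c
    unfolding F[OF i] diff_divide_distrib[symmetric] by (simp add: divide_le_eq)
  show "(\<forall>i\<in>{1..n}. 0 \<le> gbar M n \<xi> T x / ?c - ?F i (delete_coord n i x) \<and>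
      gbar M n \<xi> T x / ?c - ?F i (delete_coord n i x) \<le> 1) \<and>
    (\<Sum>i=1..n. gbar M n \<xi> T x / ?c - ?F i (delete_coord n i x)) \<le> 2 * (gbar M n \<xi> T x / ?c) + 0"
    using s b by blast
qed

end

section \<open>Tensorization of entropy on a product space\<close>

text \<open>This is ln z \<le> z - 1 at z = w v / a. It is the duality between entropy and
  exponential moments, with \<open>w\<close> a free parameter that may be chosen separately for each
  coordinate.\<close>

lemma ln_young:
  fixes a w v :: real
  assumes "0 < a" "0 < w" "0 < v"
  shows "a * ln v \<le> a * ln (a / w) - a + w * v"
proof -
  have "ln (w * v / a) \<le> w * v / a - 1"
    using assms by (intro ln_le_minus_one) auto
  then have "a * ln (w * v / a) \<le> a * (w * v / a - 1)"
    using assms by (intro mult_left_mono) auto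
  also have "a * (w * v / a - 1) = w * v - a"
    using assms by (simp add: field_simps)
  finally have "a * ln (w * v / a) \<le> w * v - a" .
  moreover have "a * ln v = a * ln (a / w) + a * ln (w * v / a)"
    using assms by (simp add: ln_div ln_mult algebra_simps)
  ultimately show ?thesis by linarith
qed

context finite_product_prob_space
begin

text \<open>Conditional expectation given the coordinates other than i. Kept as a function on the
  whole product, so that all conditionings share one space.\<close>

definition avg :: "'a \<Rightarrow> (('a \<Rightarrow> 'b) \<Rightarrow> real) \<Rightarrow> ('a \<Rightarrow> 'b) \<Rightarrow> real" where
  "avg i f x = (LINT y|M i. f (x(i := y)))"

text \<open>Pointwise and free of sigma-algebras, so that it also covers the possibly non-measurable
  functions of a self-bounding family.\<close>

definition invariant_in :: "'a \<Rightarrow> (('a \<Rightarrow> 'b) \<Rightarrow> real) \<Rightarrow> bool" where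
  "invariant_in i f \<longleftrightarrow>
     (\<forall>x\<in>space (Pi\<^sub>M I M). \<forall>y\<in>space (M i). f (x(i := y)) = f x)"

lemma invariant_inD:
  "invariant_in i f \<Longrightarrow> x \<in> space (Pi\<^sub>M I M) \<Longrightarrow> y \<in> space (M i) \<Longrightarrow> f (x(i := y)) = f x"
  by (auto simp: invariant_in_def)

lemma space_upd:
  "i \<in> I \<Longrightarrow> x \<in> space (Pi\<^sub>M I M) \<Longrightarrow> y \<in> space (M i) \<Longrightarrow> x(i := y) \<in> space (Pi\<^sub>M I M)"
  by (auto simp: space_PiM PiE_iff extensional_def)

lemma measurable_upd:
  "i \<in> I \<Longrightarrow> (\<lambda>(x, y). x(i := y)) \<in> Pi\<^sub>M I M \<Otimes>\<^sub>M M i \<rightarrow>\<^sub>M Pi\<^sub>M I M"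
  unfolding case_prod_beta by (rule measurable_fun_upd[where J = I]) auto

text \<open>Resampling one coordinate preserves the product law: the preimage of a box frees its
  side i and hands that side to the fresh variable. Fubini for \<open>avg\<close> and for null sets
  both follow from it.\<close>

lemma distr_upd:
  assumes i: "i \<in> I"
  shows "distr (Pi\<^sub>M I M \<Otimes>\<^sub>M M i) (Pi\<^sub>M I M) (\<lambda>(x, y). x(i := y)) = Pi\<^sub>M I M"
proof (rule PiM_eqI)
  fix A assume A: "\<And>j. j \<in> I \<Longrightarrow> A j \<in> sets (M j)"
  let ?A = "A(i := space (M i))"
  have A': "?A j \<in> sets (M j)" if "j \<in> I" for j
    using A that by auto
  have "emeasure (distr (Pi\<^sub>M I M \<Otimes>\<^sub>M M i) (Pi\<^sub>M I M) (\<lambda>(x, y). x(i := y))) (Pi\<^sub>E I A)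
      = emeasure (Pi\<^sub>M I M \<Otimes>\<^sub>M M i) ((\<lambda>(x, y). x(i := y)) -` Pi\<^sub>E I A \<inter> space (Pi\<^sub>M I M \<Otimes>\<^sub>M M i))"
    using i A finite_index by (intro emeasure_distr measurable_upd sets_PiM_I_finite) auto
  also have "(\<lambda>(x, y). x(i := y)) -` Pi\<^sub>E I A \<inter> space (Pi\<^sub>M I M \<Otimes>\<^sub>M M i) = Pi\<^sub>E I ?A \<times> A i"
    using i A[THEN sets.sets_into_space]
    by (auto simp: space_pair_measure space_PiM PiE_iff extensional_def split: if_splits)
       (metis in_mono)+
  also have "emeasure (Pi\<^sub>M I M \<Otimes>\<^sub>M M i) (Pi\<^sub>E I ?A \<times> A i)
      = emeasure (Pi\<^sub>M I M) (Pi\<^sub>E I ?A) * emeasure (M i) (A i)"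
    using i A A' finite_index by (intro M.emeasure_pair_measure_Times sets_PiM_I_finite) auto
  also have "emeasure (Pi\<^sub>M I M) (Pi\<^sub>E I ?A) = (\<Prod>j\<in>I. emeasure (M j) (?A j))"
    using A' finite_index by (intro emeasure_PiM) auto
  also have "\<dots> = (\<Prod>j\<in>I-{i}. emeasure (M j) (A j))"
    using i finite_index by (simp add: prod.remove M.emeasure_space_1)
  also have "\<dots> * emeasure (M i) (A i) = (\<Prod>j\<in>I. emeasure (M j) (A j))"
    using i finite_index by (simp add: prod.remove mult.commute)
  finally show "emeasure (distr (Pi\<^sub>M I M \<Otimes>\<^sub>M M i) (Pi\<^sub>M I M) (\<lambda>(x, y). x(i := y))) (Pi\<^sub>E I A)
      = (\<Prod>j\<in>I. emeasure (M j) (A j))" .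
qed (auto simp: finite_index)

lemma avg_measurable [measurable (raw)]:
  assumes [measurable]: "f \<in> borel_measurable (Pi\<^sub>M I M)" and i: "i \<in> I"
  shows "avg i f \<in> borel_measurable (Pi\<^sub>M I M)"
proof -
  have "(\<lambda>(x, y). f (x(i := y))) \<in> borel_measurable (Pi\<^sub>M I M \<Otimes>\<^sub>M M i)"
    using measurable_compose[OF measurable_upd[OF i] assms(1)] by (simp add: case_prod_beta')
  then show ?thesis
    unfolding avg_def by (rule M.borel_measurable_lebesgue_integral)
qed

lemma section_measurable:
  assumes f: "f \<in> borel_measurable (Pi\<^sub>M I M)" and i: "i \<in> I" and x: "x \<in> space (Pi\<^sub>M I M)"
  shows "(\<lambda>y. f (x(i := y))) \<in> borel_measurable (M i)"
  using measurable_compose[OF measurable_Pair1'[OF x] measurable_compose[OF measurable_upd[OF i] f]]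
  by simp

lemma integrable_bounded:
  assumes "f \<in> borel_measurable (Pi\<^sub>M I M)" "\<And>x. x \<in> space (Pi\<^sub>M I M) \<Longrightarrow> \<bar>f x\<bar> \<le> (B :: real)"
  shows "integrable (Pi\<^sub>M I M) f"
  by (rule P.integrable_const_bound[where B = B]) (use assms in auto)

lemma section_integrable:
  assumes f: "f \<in> borel_measurable (Pi\<^sub>M I M)" and i: "i \<in> I" and x: "x \<in> space (Pi\<^sub>M I M)"
    and B: "\<And>x. x \<in> space (Pi\<^sub>M I M) \<Longrightarrow> \<bar>f x\<bar> \<le> (B :: real)"
  shows "integrable (M i) (\<lambda>y. f (x(i := y)))"
  by (rule M.integrable_const_bound[where B = B])
    (use section_measurable[OF f i x] B space_upd[OF i x] in auto)

lemma integral_avg: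
  assumes f: "f \<in> borel_measurable (Pi\<^sub>M I M)" and i: "i \<in> I"
    and B: "\<And>x. x \<in> space (Pi\<^sub>M I M) \<Longrightarrow> \<bar>f x\<bar> \<le> (B :: real)"
  shows "(LINT x|Pi\<^sub>M I M. avg i f x) = (LINT x|Pi\<^sub>M I M. f x)"
proof -
  interpret pair: pair_prob_space "Pi\<^sub>M I M" "M i" ..
  have meas: "(\<lambda>(x, y). f (x(i := y))) \<in> borel_measurable (Pi\<^sub>M I M \<Otimes>\<^sub>M M i)"
    using measurable_compose[OF measurable_upd[OF i] f] by (simp add: case_prod_beta')
  have "(LINT x|Pi\<^sub>M I M. f x) = (LINT p|(Pi\<^sub>M I M \<Otimes>\<^sub>M M i). f ((\<lambda>(x, y). x(i := y)) p))"
    by (subst distr_upd[OF i, symmetric]) (rule integral_distr[OF measurable_upd[OF i] f])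
  also have "\<dots> = (LINT p|(Pi\<^sub>M I M \<Otimes>\<^sub>M M i). (\<lambda>(x, y). f (x(i := y))) p)"
    by (simp add: case_prod_beta')
  also have "\<dots> = (LINT x|Pi\<^sub>M I M. (LINT y|M i. f (x(i := y))))"
  proof (rule pair.integral_fst'[symmetric, where f = "\<lambda>(x, y). f (x(i := y))", simplified])
    show "integrable (Pi\<^sub>M I M \<Otimes>\<^sub>M M i) (\<lambda>(x, y). f (x(i := y)))"
      by (rule pair.P.integrable_const_bound[where B = B])
        (use meas B space_upd[OF i] in \<open>auto simp: space_pair_measure\<close>)
  qed
  finally show ?thesis by (simp add: avg_def)
qed

lemma AE_avg:
  assumes i: "i \<in> I" and "AE x in Pi\<^sub>M I M. Q x"
  shows "AE x in Pi\<^sub>M I M. AE y in M i. Q (x(i := y))"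
proof -
  interpret pair: pair_prob_space "Pi\<^sub>M I M" "M i" ..
  have "AE x in distr (Pi\<^sub>M I M \<Otimes>\<^sub>M M i) (Pi\<^sub>M I M) (\<lambda>(x, y). x(i := y)). Q x"
    unfolding distr_upd[OF i] by fact
  from AE_distrD[OF measurable_upd[OF i] this]
  have "AE p in Pi\<^sub>M I M \<Otimes>\<^sub>M M i. Q ((\<lambda>(x, y). x(i := y)) p)" .
  then show ?thesis
    using pair.AE_pair[of "\<lambda>p. Q ((\<lambda>(x, y). x(i := y)) p)"] by simp
qed

lemma avg_invariant_self: "invariant_in i (avg i f)"
  by (simp add: invariant_in_def avg_def)

lemma avg_invariant:
  assumes i: "i \<in> I" and j: "j \<in> I" and f: "invariant_in j f"
  shows "invariant_in j (avg i f)"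
proof (cases "i = j")
  case False
  show ?thesis
    unfolding invariant_in_def
  proof (intro ballI)
    fix x y assume x: "x \<in> space (Pi\<^sub>M I M)" and y: "y \<in> space (M j)"
    show "avg i f (x(j := y)) = avg i f x"
      unfolding avg_def
    proof (rule Bochner_Integration.integral_cong[OF refl])
      fix z assume z: "z \<in> space (M i)"
      have "f ((x(j := y))(i := z)) = f ((x(i := z))(j := y))"
        using False by (simp add: fun_upd_twist)
      also have "\<dots> = f (x(i := z))"
        by (rule invariant_inD[OF f space_upd[OF i x z] y])
      finally show "f ((x(j := y))(i := z)) = f (x(i := z))" .
    qed
  qed
qed (simp add: avg_invariant_self)

lemma avg_mult_invariant:
  assumes "invariant_in i w" "x \<in> space (Pi\<^sub>M I M)"
  shows "avg i (\<lambda>x. w x * f x) x = w x * avg i f x"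
proof -
  have "avg i (\<lambda>x. w x * f x) x = (LINT y|M i. w x * f (x(i := y)))"
    unfolding avg_def using assms
    by (intro Bochner_Integration.integral_cong) (auto simp: invariant_inD)
  then show ?thesis by (simp add: avg_def)
qed

lemma avg_bounds:
  assumes f: "f \<in> borel_measurable (Pi\<^sub>M I M)" and i: "i \<in> I" and x: "x \<in> space (Pi\<^sub>M I M)"
    and b: "\<And>x. x \<in> space (Pi\<^sub>M I M) \<Longrightarrow> a \<le> f x \<and> f x \<le> (b :: real)"
  shows "a \<le> avg i f x \<and> avg i f x \<le> b"
proof -
  have int: "integrable (M i) (\<lambda>y. f (x(i := y)))"
    by (rule section_integrable[OF f i x, of "\<bar>a\<bar> + \<bar>b\<bar>"]) (use b in force)
  show ?thesis
    unfolding avg_def using b space_upd[OF i x]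
    by (intro conjI M.integral_ge_const[OF int] M.integral_le_const[OF int]) auto
qed

text \<open>The coordinates of \<open>x\<close> are exchanged for those of \<open>z\<close> one at a
  time.\<close>

lemma invariant_in_all:
  assumes f: "\<And>i. i \<in> I \<Longrightarrow> invariant_in i f"
    and x: "x \<in> space (Pi\<^sub>M I M)" and z: "z \<in> space (Pi\<^sub>M I M)"
  shows "f x = f z"
proof -
  have "f (\<lambda>i. if i \<in> K then z i else x i) = f x" if "finite K" "K \<subseteq> I" for K
    using that
  proof (induction K rule: finite_induct)
    case (insert k K)
    let ?u = "\<lambda>i. if i \<in> K then z i else x i"
    have u: "?u \<in> space (Pi\<^sub>M I M)"
      using x z insert.prems by (auto simp: space_PiM PiE_iff extensional_def)
    have "(\<lambda>i. if i \<in> insert k K then z i else x i) = ?u(k := z k)"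
      by auto
    moreover have "z k \<in> space (M k)"
      using z insert.prems by (auto simp: space_PiM)
    ultimately show ?case
      using invariant_inD[OF f u] insert by auto
  qed simp
  from this[OF finite_index order.refl]
  have "f (\<lambda>i. if i \<in> I then z i else x i) = f x" .
  moreover have "(\<lambda>i. if i \<in> I then z i else x i) = z"
    using x z by (auto simp: space_PiM PiE_iff extensional_def)
  ultimately show ?thesis by simp
qed

text \<open>The function $V$ is the conditional expectation of $Y$ given the coordinates outside $J$.
  One step of the induction replaces $V$ by \<open>avg k V\<close>; the inequality \<open>ln_young\<close>
  with $v = V / \mathtt{avg}\,k\,V$ then integrates to the required bound because $v$ has average $1$
  in coordinate $k$ and $w_k$ does not depend on that coordinate.\<close>

lemma entropy_tensorization_aux:
  assumes Y: "Y \<in> borel_measurable (Pi\<^sub>M I M)"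
    and w: "\<And>i. i \<in> I \<Longrightarrow> w i \<in> borel_measurable (Pi\<^sub>M I M)" "\<And>i. i \<in> I \<Longrightarrow> invariant_in i (w i)"
    and a: "0 < a"
    and Yb: "\<And>x. x \<in> space (Pi\<^sub>M I M) \<Longrightarrow> a \<le> Y x \<and> Y x \<le> (b :: real)"
    and wb: "\<And>i x. i \<in> I \<Longrightarrow> x \<in> space (Pi\<^sub>M I M) \<Longrightarrow> a \<le> w i x \<and> w i x \<le> b"
    and J: "finite J" "J \<subseteq> I"
  shows "\<exists>V \<in> borel_measurable (Pi\<^sub>M I M).
    (\<forall>x\<in>space (Pi\<^sub>M I M). a \<le> V x \<and> V x \<le> b) \<and> (\<forall>j\<in>J. invariant_in j V) \<and>
    (LINT x|Pi\<^sub>M I M. V x) = (LINT x|Pi\<^sub>M I M. Y x) \<and>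
    (LINT x|Pi\<^sub>M I M. Y x * (ln (Y x) - ln (V x)))
      \<le> (\<Sum>i\<in>J. LINT x|Pi\<^sub>M I M. Y x * ln (Y x / w i x) - Y x + w i x)"
  using J
proof (induction J rule: finite_induct)
  case empty
  show ?case using Y Yb by (intro bexI[of _ Y]) auto
next
  case (insert k J)
  let ?P = "Pi\<^sub>M I M"
  have k: "k \<in> I" and JI: "J \<subseteq> I" using insert.prems by auto
  from insert.IH[OF JI] obtain V where V: "V \<in> borel_measurable ?P"
    and Vb: "\<And>x. x \<in> space ?P \<Longrightarrow> a \<le> V x \<and> V x \<le> b" and Vi: "\<And>j. j \<in> J \<Longrightarrow> invariant_in j V"
    and VY: "(LINT x|?P. V x) = (LINT x|?P. Y x)"
    and Vle: "(LINT x|?P. Y x * (ln (Y x) - ln (V x)))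
      \<le> (\<Sum>i\<in>J. LINT x|?P. Y x * ln (Y x / w i x) - Y x + w i x)"
    by blast
  let ?U = "avg k V"
  have U: "?U \<in> borel_measurable ?P" by (rule avg_measurable[OF V k])
  have Ub: "a \<le> ?U x \<and> ?U x \<le> b" if "x \<in> space ?P" for x
    by (rule avg_bounds[OF V k that Vb])
  obtain z where "z \<in> space ?P" using P.not_empty by blast
  then have ab: "a \<le> b" using Yb[of z] by linarith
  \<comment> \<open>The bounds 0 < a \<le> s \<le> b keep all logarithms bounded, so that every
    integral below exists.\<close>
  have lnb: "\<bar>ln s\<bar> \<le> \<bar>ln a\<bar> + \<bar>ln b\<bar>" if "a \<le> s \<and> s \<le> b" for s
  proof -
    have "ln a \<le> ln s" "ln s \<le> ln b" using that a by auto
    then show ?thesis by linarith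
  qed
  have int: "integrable ?P (\<lambda>x. Y x * ln (s x))"
    if s: "s \<in> borel_measurable ?P" and sb: "\<And>x. x \<in> space ?P \<Longrightarrow> a \<le> s x \<and> s x \<le> b" for s
  proof (rule integrable_bounded[where B = "b * (\<bar>ln a\<bar> + \<bar>ln b\<bar>)"])
    fix x assume x: "x \<in> space ?P"
    show "\<bar>Y x * ln (s x)\<bar> \<le> b * (\<bar>ln a\<bar> + \<bar>ln b\<bar>)"
      unfolding abs_mult using Yb[OF x] lnb[OF sb[OF x]] a by (intro mult_mono) auto
  qed (use Y s in measurable)
  have intb: "integrable ?P s"
    if s: "s \<in> borel_measurable ?P" and sb: "\<And>x. x \<in> space ?P \<Longrightarrow> a \<le> s x \<and> s x \<le> b" for s
    by (rule integrable_bounded[OF s, of b]) (use sb a in force)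
  have pos: "0 < Y x" "0 < V x" "0 < ?U x" "0 < w k x" if "x \<in> space ?P" for x
    using Yb[OF that] Vb[OF that] Ub[OF that] wb[OF k that] a by auto
  have mw: "w k \<in> borel_measurable ?P" by (rule w(1)[OF k])
  have mq: "(\<lambda>x. w k x / ?U x * V x) \<in> borel_measurable ?P"
    using mw U V by measurable
  have qb: "\<bar>w k x / ?U x * V x\<bar> \<le> b / a * b" if x: "x \<in> space ?P" for x
  proof -
    have "w k x / ?U x * V x \<le> b / a * b"
      using pos[OF x] wb[OF k x] Ub[OF x] Vb[OF x] a ab by (intro mult_mono frac_le) auto
    moreover have "0 \<le> w k x / ?U x * V x" using pos[OF x] by simp
    ultimately show ?thesis by simp
  qed
  have avq: "(LINT x|?P. w k x / ?U x * V x) = (LINT x|?P. w k x)"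
  proof -
    have inv: "invariant_in k (\<lambda>x. w k x / ?U x)"
      using w(2)[OF k] avg_invariant_self[of k V] by (simp add: invariant_in_def)
    have "(LINT x|?P. w k x / ?U x * V x) = (LINT x|?P. avg k (\<lambda>x. w k x / ?U x * V x) x)"
      by (rule integral_avg[OF mq k qb, symmetric])
    also have "\<dots> = (LINT x|?P. w k x)"
    proof (rule Bochner_Integration.integral_cong[OF refl])
      fix x assume x: "x \<in> space ?P"
      show "avg k (\<lambda>x. w k x / ?U x * V x) x = w k x"
        unfolding avg_mult_invariant[OF inv x] using pos(3)[OF x] by simp
    qed
    finally show ?thesis .
  qed
  have intq: "integrable ?P (\<lambda>x. w k x / ?U x * V x)"
    by (rule integrable_bounded[OF mq qb])
  have intln: "integrable ?P (\<lambda>x. Y x * ln (Y x / w k x))"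
  proof -
    have "integrable ?P (\<lambda>x. Y x * ln (Y x) - Y x * ln (w k x))"
      using int[OF Y Yb] int[OF mw wb[OF k]] by simp
    then show ?thesis
      by (rule Bochner_Integration.integrable_cong[OF refl, THEN iffD1, rotated])
        (use pos in \<open>force simp: ln_div right_diff_distrib\<close>)
  qed
  have "(LINT x|?P. Y x * (ln (V x) - ln (?U x)))
      \<le> (LINT x|?P. (Y x * ln (Y x / w k x) - Y x) + w k x / ?U x * V x)"
  proof (rule integral_mono)
    fix x assume x: "x \<in> space ?P"
    show "Y x * (ln (V x) - ln (?U x)) \<le> (Y x * ln (Y x / w k x) - Y x) + w k x / ?U x * V x"
      using ln_young[of "Y x" "w k x" "V x / ?U x"] pos[OF x] by (simp add: ln_div)
  qed (use int[OF V Vb] int[OF U Ub] intln intb[OF Y Yb] intq in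
      \<open>auto simp: right_diff_distrib\<close>)
  also have "\<dots> = (LINT x|?P. Y x * ln (Y x / w k x) - Y x) + (LINT x|?P. w k x)"
    using intln intb[OF Y Yb] intq avq by (subst Bochner_Integration.integral_add) auto
  also have "\<dots> = (LINT x|?P. Y x * ln (Y x / w k x) - Y x + w k x)"
    using intln intb[OF Y Yb] intb[OF mw wb[OF k]]
    by (subst Bochner_Integration.integral_add[symmetric]) auto
  finally have step: "(LINT x|?P. Y x * (ln (V x) - ln (?U x)))
      \<le> (LINT x|?P. Y x * ln (Y x / w k x) - Y x + w k x)" .
  \<comment> \<open>Chain rule for entropy: the logarithmic difference is split at \<open>V\<close>;
    the first part is the induction hypothesis, the second is \<open>step\<close>.\<close>
  have "(LINT x|?P. Y x * (ln (Y x) - ln (?U x)))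
      = (LINT x|?P. Y x * (ln (Y x) - ln (V x)) + Y x * (ln (V x) - ln (?U x)))"
    by (intro Bochner_Integration.integral_cong) (auto simp: algebra_simps)
  also have "\<dots> = (LINT x|?P. Y x * (ln (Y x) - ln (V x))) + (LINT x|?P. Y x * (ln (V x) - ln (?U x)))"
    using int[OF V Vb] int[OF U Ub] int[OF Y Yb]
    by (intro Bochner_Integration.integral_add) (auto simp: right_diff_distrib)
  also have "\<dots> \<le> (\<Sum>i\<in>insert k J. LINT x|?P. Y x * ln (Y x / w i x) - Y x + w i x)"
    using Vle step insert.hyps by simp
  finally have "(LINT x|?P. Y x * (ln (Y x) - ln (?U x)))
      \<le> (\<Sum>i\<in>insert k J. LINT x|?P. Y x * ln (Y x / w i x) - Y x + w i x)" .
  moreover have "(LINT x|?P. ?U x) = (LINT x|?P. Y x)"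
    using integral_avg[OF V k, of b] Vb a VY by force
  moreover have "\<forall>j\<in>insert k J. invariant_in j ?U"
    using avg_invariant_self avg_invariant[OF k _ Vi] JI by auto
  ultimately show ?case
    using U Ub by (intro bexI[of _ ?U]) auto
qed

text \<open>Once all coordinates are integrated out, \<open>V\<close> is constant and equal to the
  mean of \<open>Y\<close>, so the left-hand side of the induction becomes the entropy.\<close>

lemma entropy_tensorization:
  assumes Y: "Y \<in> borel_measurable (Pi\<^sub>M I M)"
    and w: "\<And>i. i \<in> I \<Longrightarrow> w i \<in> borel_measurable (Pi\<^sub>M I M)" "\<And>i. i \<in> I \<Longrightarrow> invariant_in i (w i)"
    and a: "0 < a"
    and Yb: "\<And>x. x \<in> space (Pi\<^sub>M I M) \<Longrightarrow> a \<le> Y x \<and> Y x \<le> (b :: real)"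
    and wb: "\<And>i x. i \<in> I \<Longrightarrow> x \<in> space (Pi\<^sub>M I M) \<Longrightarrow> a \<le> w i x \<and> w i x \<le> b"
  shows "(LINT x|Pi\<^sub>M I M. Y x * (ln (Y x) - ln (LINT x|Pi\<^sub>M I M. Y x)))
    \<le> (\<Sum>i\<in>I. LINT x|Pi\<^sub>M I M. Y x * ln (Y x / w i x) - Y x + w i x)"
proof -
  let ?P = "Pi\<^sub>M I M"
  obtain V where V: "V \<in> borel_measurable ?P" "\<forall>j\<in>I. invariant_in j V"
    and VY: "(LINT x|?P. V x) = (LINT x|?P. Y x)"
    and le: "(LINT x|?P. Y x * (ln (Y x) - ln (V x)))
      \<le> (\<Sum>i\<in>I. LINT x|?P. Y x * ln (Y x / w i x) - Y x + w i x)"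
    using entropy_tensorization_aux[OF Y w a Yb wb finite_index order.refl] by blast
  obtain z where z: "z \<in> space ?P" using P.not_empty by blast
  have V_const: "V x = V z" if "x \<in> space ?P" for x
    by (rule invariant_in_all[OF _ that z]) (use V in auto)
  have "(LINT x|?P. V x) = (LINT x|?P. V z)"
    by (rule Bochner_Integration.integral_cong[OF refl V_const])
  then have "V z = (LINT x|?P. Y x)"
    using VY by (simp add: P.prob_space)
  then have "(LINT x|?P. Y x * (ln (Y x) - ln (V x)))
      = (LINT x|?P. Y x * (ln (Y x) - ln (LINT x|?P. Y x)))"
    using V_const by (intro Bochner_Integration.integral_cong) auto
  with le show ?thesis by simp
qed

section \<open>The entropy inequality for self-bounding functions\<close>

text \<open>The functions $f_i$ of a self-bounding function need not be measurable.  The essential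
  infimum of $Z$ over the $i$-th coordinate is a measurable replacement that lies between $f_i$
  and $Z$; it is built as a supremum over rationals to make measurability visible.\<close>

definition coordinate_essinf :: "'a \<Rightarrow> real \<Rightarrow> (('a \<Rightarrow> 'b) \<Rightarrow> real) \<Rightarrow> ('a \<Rightarrow> 'b) \<Rightarrow> real" where
  "coordinate_essinf i B Z x =
     (SUP q\<in>\<rat> \<inter> {0..B}. if avg i (\<lambda>x. if Z x < q then 1 else 0) x = 0 then q else 0)"

text \<open>A level q counts when \<open>Z\<close> falls below q with conditional probability zero.
  For one q the exceptional set is null, and countably many q give m \<le> Z almost everywhere.
  Conversely, every rational q in [0, B] below an almost sure lower bound r of a section counts. The
  default 0 for the other levels is harmless because Z \<ge> 0.\<close>

lemma coordinate_essinf: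
  assumes Z: "Z \<in> borel_measurable (Pi\<^sub>M I M)" and i: "i \<in> I" and B: "0 \<le> B"
    and Zb: "\<And>x. x \<in> space (Pi\<^sub>M I M) \<Longrightarrow> 0 \<le> Z x \<and> Z x \<le> (B :: real)"
  defines "m \<equiv> coordinate_essinf i B Z"
  shows "m \<in> borel_measurable (Pi\<^sub>M I M)" "invariant_in i m"
    "0 \<le> m x \<and> m x \<le> B"
    "AE x in Pi\<^sub>M I M. m x \<le> Z x"
    "x \<in> space (Pi\<^sub>M I M) \<Longrightarrow> AE y in M i. r \<le> Z (x(i := y)) \<Longrightarrow> r \<le> m x"
proof -
  let ?P = "Pi\<^sub>M I M"
  let ?Q = "\<rat> \<inter> {0..B}"
  let ?ind = "\<lambda>q x. if Z x < q then 1 else 0 :: real"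
  let ?g = "\<lambda>q x. if avg i (?ind q) x = 0 then q else 0"
  have m_def: "m = (\<lambda>x. SUP q\<in>?Q. ?g q x)"
    by (simp add: m_def coordinate_essinf_def fun_eq_iff)
  have Q0: "0 \<in> ?Q" using B by auto
  have cQ: "countable ?Q" using countable_rat by (rule countable_subset[rotated]) auto
  have ind: "?ind q \<in> borel_measurable ?P" for q using Z by measurable
  have avg_ind: "avg i (?ind q) \<in> borel_measurable ?P" for q by (rule avg_measurable[OF ind i])
  have bdd: "bdd_above ((\<lambda>q. ?g q x) ` ?Q)" for x
    by (rule bdd_aboveI[where M = B]) (use B in auto)
  have upper: "?g q x \<le> m x" if "q \<in> ?Q" for q x
    unfolding m_def by (rule cSUP_upper[OF that bdd])
  show "m \<in> borel_measurable ?P"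
    unfolding m_def using cQ bdd avg_ind by (intro borel_measurable_cSUP) (auto intro!: measurable_If)
  show "invariant_in i m"
    using avg_invariant_self[of i "?ind _"] unfolding m_def invariant_in_def by simp
  have mb: "0 \<le> m x \<and> m x \<le> B" for x
  proof
    show "0 \<le> m x" using upper[OF Q0, of x] by simp
    show "m x \<le> B" unfolding m_def using Q0 B by (intro cSUP_least) auto
  qed
  then show "0 \<le> m x \<and> m x \<le> B" .
  have "AE x in ?P. \<forall>q\<in>?Q. avg i (?ind q) x = 0 \<longrightarrow> q \<le> Z x"
    unfolding AE_ball_countable[OF cQ]
  proof
    fix q assume "q \<in> ?Q"
    let ?c = "\<lambda>x. if avg i (?ind q) x = 0 then 1 else 0 :: real"
    \<comment> \<open>Indicator of the exceptional set. As \<open>?c\<close> ignores coordinate i,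
      averaging over that coordinate yields \<open>?c\<close> times a conditional probability that
      vanishes wherever \<open>?c\<close> does not.\<close>
    let ?h = "\<lambda>x. ?c x * ?ind q x"
    have h: "?h \<in> borel_measurable ?P" using avg_ind ind by measurable
    have hb: "\<bar>?h x\<bar> \<le> 1" for x by simp
    have c: "invariant_in i ?c"
      using avg_invariant_self[of i "?ind q"] by (simp add: invariant_in_def)
    have "(LINT x|?P. ?h x) = (LINT x|?P. avg i ?h x)"
      by (rule integral_avg[OF h i hb, symmetric])
    also have "\<dots> = (LINT x|?P. 0)"
      by (rule Bochner_Integration.integral_cong[OF refl])
        (use avg_mult_invariant[OF c, of _ "?ind q"] in auto)
    finally have "(LINT x|?P. ?h x) = 0" by simp
    moreover have "integrable ?P ?h" by (rule integrable_bounded[OF h hb])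
    ultimately have "AE x in ?P. ?h x = 0"
      by (subst (asm) integral_nonneg_eq_0_iff_AE) auto
    then show "AE x in ?P. avg i (?ind q) x = 0 \<longrightarrow> q \<le> Z x"
      by eventually_elim (auto split: if_splits)
  qed
  then show "AE x in ?P. m x \<le> Z x"
    using AE_space
  proof eventually_elim
    case (elim x)
    then show ?case
      unfolding m_def using Q0 Zb by (intro cSUP_least) auto
  qed
  assume x: "x \<in> space ?P" and r: "AE y in M i. r \<le> Z (x(i := y))"
  show "r \<le> m x"
  proof (rule ccontr)
    assume "\<not> r \<le> m x"
    then obtain q where q: "q \<in> \<rat>" "m x < q" "q < r"
      using Rats_dense_in_real[of "m x" r] by auto
    \<comment> \<open>On a probability space an almost sure statement about constants is true; it
      places q inside [0, B].\<close>
    have "AE y in M i. r \<le> B"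
      using r AE_space by eventually_elim (use Zb space_upd[OF i x] in force)
    then have "r \<le> B" by simp
    then have qQ: "q \<in> ?Q" using q mb[of x] by auto
    have "avg i (?ind q) x = (LINT y|M i. 0)"
      unfolding avg_def
    proof (rule integral_cong_AE[OF section_measurable[OF ind i x]])
      show "AE y in M i. (if Z (x(i := y)) < q then 1 else 0) = (0 :: real)"
        using r by eventually_elim (use q in simp)
    qed simp
    then show False using upper[OF qQ, of x] q by simp
  qed
qed

text \<open>Tensorization is applied with w_i = exp(l m_i), which makes each term \<open>Y\<close>
  times exp(-l u) - 1 + l u for u = Z - m_i. Since F_i \<le> m_i \<le> Z \<le> F_i + 1, this u lies
  in [0,1] and the slope \<open>\<rho>\<close> applies; as \<open>\<rho>\<close> is nonnegative, m_i
  may then be lowered to F_i and the sum condition used. Leaving \<open>\<rho>\<close> free serves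
  both signs of \<open>l\<close>.\<close>

lemma self_bounding_entropy:
  fixes F :: "'a \<Rightarrow> ('a \<Rightarrow> 'b) \<Rightarrow> real"
  assumes Z: "Z \<in> borel_measurable (Pi\<^sub>M I M)" and B: "0 \<le> B"
    and Zb: "\<And>x. x \<in> space (Pi\<^sub>M I M) \<Longrightarrow> 0 \<le> Z x \<and> Z x \<le> (B :: real)"
    and Fi: "\<And>i. i \<in> I \<Longrightarrow> invariant_in i (F i)"
    and F: "AE x in Pi\<^sub>M I M. \<forall>i\<in>I. F i x \<le> Z x \<and> Z x \<le> F i x + 1"
    and Fsum: "AE x in Pi\<^sub>M I M. (\<Sum>i\<in>I. Z x - F i x) \<le> a * Z x"
    and \<rho>: "\<And>u. 0 \<le> u \<Longrightarrow> u \<le> 1 \<Longrightarrow> exp (- l * u) - 1 + l * u \<le> \<rho> * u"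
  shows "l * (LINT x|Pi\<^sub>M I M. Z x * exp (l * Z x))
      - (LINT x|Pi\<^sub>M I M. exp (l * Z x)) * ln (LINT x|Pi\<^sub>M I M. exp (l * Z x))
    \<le> a * \<rho> * (LINT x|Pi\<^sub>M I M. Z x * exp (l * Z x))"
proof -
  let ?P = "Pi\<^sub>M I M"
  define m where "m i = coordinate_essinf i B Z" for i
  have ess: "m i \<in> borel_measurable ?P" "invariant_in i (m i)" "0 \<le> m i x \<and> m i x \<le> B"
    "AE x in ?P. m i x \<le> Z x"
    "x \<in> space ?P \<Longrightarrow> AE y in M i. r \<le> Z (x(i := y)) \<Longrightarrow> r \<le> m i x"
    if "i \<in> I" for i x r
    using coordinate_essinf[OF Z that B Zb] unfolding m_def by blast+
  note m = ess(1) and mi = ess(2) and mb = ess(3) and mZ = ess(4) and mr = ess(5)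
  \<comment> \<open>\<open>F i\<close> ignores coordinate i, so its value at \<open>x\<close> is an
    almost sure lower bound of the whole section of \<open>Z\<close> through
    \<open>x\<close>.\<close>
  have Fm: "AE x in ?P. F i x \<le> m i x" if i: "i \<in> I" for i
  proof -
    have "AE x in ?P. F i x \<le> Z x"
      using F by eventually_elim (use i in auto)
    from AE_avg[OF i this] AE_space show ?thesis
    proof eventually_elim
      case (elim x)
      have "AE y in M i. F i x \<le> Z (x(i := y))"
        using elim(1) AE_space
        by eventually_elim (use invariant_inD[OF Fi[OF i] elim(2)] in simp)
      then show ?case by (rule mr[OF i elim(2)])
    qed
  qed
  have \<rho>0: "0 \<le> \<rho>"
    using \<rho>[of 1] exp_ge_add_one_self[of "- l"] by simp
  have all: "AE x in ?P. \<forall>i\<in>I. F i x \<le> m i x \<and> m i x \<le> Z x"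
    using Fm mZ finite_index by (subst AE_ball_countable) (auto simp: countable_finite)
  let ?Y = "\<lambda>x. exp (l * Z x)"
  let ?w = "\<lambda>i x. exp (l * m i x)"
  let ?b = "exp (\<bar>l\<bar> * B)"
  have expb: "exp (- (\<bar>l\<bar> * B)) \<le> exp (l * s) \<and> exp (l * s) \<le> ?b" if "0 \<le> s \<and> s \<le> B" for s
  proof -
    have "\<bar>l * s\<bar> \<le> \<bar>l\<bar> * B"
      unfolding abs_mult using that by (intro mult_left_mono) auto
    then show ?thesis by auto
  qed
  have Ym: "?Y \<in> borel_measurable ?P" using Z by measurable
  have wm: "?w i \<in> borel_measurable ?P" if "i \<in> I" for i using m[OF that] by measurable
  have wi: "invariant_in i (?w i)" if "i \<in> I" for i
    using mi[OF that] by (simp add: invariant_in_def)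
  have tens: "(LINT x|?P. ?Y x * (ln (?Y x) - ln (LINT x|?P. ?Y x)))
    \<le> (\<Sum>i\<in>I. LINT x|?P. ?Y x * ln (?Y x / ?w i x) - ?Y x + ?w i x)"
    by (rule entropy_tensorization[OF Ym wm wi, where a = "exp (- (\<bar>l\<bar> * B))" and b = ?b])
      (use expb Zb mb in auto)
  have intY: "integrable ?P ?Y"
    by (rule integrable_bounded[OF Ym, of ?b]) (use expb Zb in auto)
  have ZY: "(\<lambda>x. Z x * ?Y x) \<in> borel_measurable ?P" using Z by measurable
  have intZY: "integrable ?P (\<lambda>x. Z x * ?Y x)"
  proof (rule integrable_bounded[OF ZY, of "B * ?b"])
    fix x assume "x \<in> space ?P"
    then show "\<bar>Z x * ?Y x\<bar> \<le> B * ?b"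
      unfolding abs_mult using Zb expb B by (intro mult_mono) auto
  qed
  have term_eq: "?Y x * ln (?Y x / ?w i x) - ?Y x + ?w i x
      = ?Y x * (exp (- l * (Z x - m i x)) - 1 + l * (Z x - m i x))" for i x
  proof -
    have "?Y x / ?w i x = exp (l * (Z x - m i x))"
      by (simp add: exp_diff[symmetric] right_diff_distrib)
    moreover have "?w i x = ?Y x * exp (- l * (Z x - m i x))"
      by (simp add: exp_add[symmetric] algebra_simps)
    ultimately show ?thesis by (simp add: algebra_simps)
  qed
  have int_term: "integrable ?P (\<lambda>x. ?Y x * ln (?Y x / ?w i x) - ?Y x + ?w i x)" if i: "i \<in> I" for i
  proof -
    have meas: "(\<lambda>x. ?Y x * (l * (Z x - m i x))) \<in> borel_measurable ?P"
      using Z m[OF i] by measurable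
    have "integrable ?P (\<lambda>x. ?Y x * (l * (Z x - m i x)))"
    proof (rule integrable_bounded[OF meas, of "?b * (\<bar>l\<bar> * B)"])
      fix x assume x: "x \<in> space ?P"
      have "\<bar>Z x - m i x\<bar> \<le> B" using Zb[OF x] mb[OF i, of x] by auto
      then show "\<bar>?Y x * (l * (Z x - m i x))\<bar> \<le> ?b * (\<bar>l\<bar> * B)"
        unfolding abs_mult using Zb[OF x] expb B by (intro mult_mono) auto
    qed
    moreover have "integrable ?P (?w i)"
      by (rule integrable_bounded[OF wm[OF i], of ?b]) (use expb mb[OF i] in auto)
    ultimately have "integrable ?P (\<lambda>x. ?Y x * (l * (Z x - m i x)) - ?Y x + ?w i x)"
      using intY by auto
    moreover have "ln (?Y x / ?w i x) = l * (Z x - m i x)" for x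
      by (simp add: exp_diff[symmetric] right_diff_distrib)
    ultimately show ?thesis by simp
  qed
  have "l * (LINT x|?P. Z x * ?Y x) - (LINT x|?P. ?Y x) * ln (LINT x|?P. ?Y x)
      = (LINT x|?P. l * (Z x * ?Y x) - ?Y x * ln (LINT x|?P. ?Y x))"
    using intY intZY by simp
  also have "\<dots> = (LINT x|?P. ?Y x * (ln (?Y x) - ln (LINT x|?P. ?Y x)))"
    by (intro Bochner_Integration.integral_cong) (auto simp: algebra_simps)
  also have "\<dots> \<le> (\<Sum>i\<in>I. LINT x|?P. ?Y x * ln (?Y x / ?w i x) - ?Y x + ?w i x)"
    by (rule tens)
  also have "\<dots> = (LINT x|?P. (\<Sum>i\<in>I. ?Y x * ln (?Y x / ?w i x) - ?Y x + ?w i x))"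
    using int_term by (rule Bochner_Integration.integral_sum[symmetric])
  also have "\<dots> \<le> (LINT x|?P. a * \<rho> * (Z x * ?Y x))"
  proof (rule integral_mono_AE)
    show "integrable ?P (\<lambda>x. \<Sum>i\<in>I. ?Y x * ln (?Y x / ?w i x) - ?Y x + ?w i x)"
      using int_term by (rule Bochner_Integration.integrable_sum)
    show "integrable ?P (\<lambda>x. a * \<rho> * (Z x * ?Y x))" using intZY by simp
    show "AE x in ?P. (\<Sum>i\<in>I. ?Y x * ln (?Y x / ?w i x) - ?Y x + ?w i x) \<le> a * \<rho> * (Z x * ?Y x)"
      using all F Fsum
    proof eventually_elim
      case (elim x)
      have "(\<Sum>i\<in>I. ?Y x * ln (?Y x / ?w i x) - ?Y x + ?w i x) \<le> (\<Sum>i\<in>I. ?Y x * (\<rho> * (Z x - F i x)))"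
      proof (rule sum_mono)
        fix i assume i: "i \<in> I"
        have "exp (- l * (Z x - m i x)) - 1 + l * (Z x - m i x) \<le> \<rho> * (Z x - m i x)"
          by (rule \<rho>) (use elim i in force)+
        also have "\<dots> \<le> \<rho> * (Z x - F i x)"
          using elim(1) i \<rho>0 by (intro mult_left_mono) auto
        finally show "?Y x * ln (?Y x / ?w i x) - ?Y x + ?w i x \<le> ?Y x * (\<rho> * (Z x - F i x))"
          unfolding term_eq by (intro mult_left_mono) auto
      qed
      also have "\<dots> = ?Y x * \<rho> * (\<Sum>i\<in>I. Z x - F i x)"
        by (simp add: sum_distrib_left mult.assoc)
      also have "\<dots> \<le> ?Y x * \<rho> * (a * Z x)"
        using elim(3) \<rho>0 by (intro mult_left_mono) auto
      finally show ?case by (simp add: algebra_simps)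
    qed
  qed
  also have "\<dots> = a * \<rho> * (LINT x|?P. Z x * ?Y x)" by simp
  finally show ?thesis .
qed

end

section \<open>From the entropy inequality to tail bounds\<close>

lemma exp_minus_one_minus_le_square:
  fixes u :: real
  assumes "\<bar>u\<bar> \<le> 1"
  shows "\<bar>exp u - 1 - u\<bar> \<le> u\<^sup>2"
proof (cases "0 \<le> u")
  case True
  then show ?thesis
    using exp_bound[of u] exp_ge_add_one_self[of u] zero_le_power2[of u] assms
    unfolding abs_le_iff by linarith
next
  case False
  have "(1 - u) * exp u \<le> exp (- u) * exp u"
    using exp_ge_add_one_self[of "- u"] by (intro mult_right_mono) auto
  also have "\<dots> = 1" by (simp add: exp_add[symmetric])
  \<comment> \<open>The product is 1 - u^3, and u is negative.\<close>
  also have "1 \<le> (1 - u) * (1 + u + u\<^sup>2)"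
  proof -
    have "u * u\<^sup>2 \<le> 0" using False by (intro mult_nonpos_nonneg) auto
    then show ?thesis by (simp add: algebra_simps power2_eq_square)
  qed
  finally have "exp u \<le> 1 + u + u\<^sup>2"
    using False by simp
  then show ?thesis
    using exp_ge_add_one_self[of u] zero_le_power2[of u] unfolding abs_le_iff by linarith
qed

lemma exp_minus_le_quadratic:
  fixes v :: real
  assumes "0 \<le> v"
  shows "exp (- v) \<le> 1 - v + v\<^sup>2 / 2"
proof -
  obtain t where "exp (- v) = (\<Sum>m<3. (- v) ^ m / fact m) + exp t / fact 3 * (- v) ^ 3"
    using Maclaurin_exp_le[of "- v" 3] by blast
  moreover have "exp t / fact 3 * (- v) ^ 3 \<le> 0"
    using assms by (intro mult_nonneg_nonpos) (auto simp: power3_eq_cube mult_nonneg_nonpos2)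
  ultimately show ?thesis by (simp add: numeral_3_eq_3 power2_eq_square)
qed

text \<open>The Maclaurin remainder has coefficient at most e/6 \<le> 1/2. This gives s + 2 (e^s - s
  - 1) \<le> s + s^2 + s^3, sharp enough for the lower tail.\<close>

lemma exp_le_cubic:
  fixes s :: real
  assumes "0 \<le> s" "s \<le> 1"
  shows "exp s \<le> 1 + s + s\<^sup>2 / 2 + s ^ 3 / 2"
proof -
  obtain t where t: "\<bar>t\<bar> \<le> \<bar>s\<bar>" "exp s = (\<Sum>m<3. s ^ m / fact m) + exp t / fact 3 * s ^ 3"
    using Maclaurin_exp_le[of s 3] by blast
  have "exp t \<le> exp 1" using t(1) assms by auto
  also have "\<dots> \<le> 3" by (rule exp_le)
  finally have "exp t / fact 3 * s ^ 3 \<le> 1 / 2 * s ^ 3"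
    using assms by (intro mult_right_mono) (auto simp: fact_numeral)
  then show ?thesis using t(2) by (simp add: numeral_3_eq_3 power2_eq_square)
qed

text \<open>The chord of the exponential. It supplies the slope e^s - s - 1 for the entropy
  inequality at the parameter -s.\<close>

lemma exp_convex_unit:
  fixes s u :: real
  assumes "0 \<le> u" "u \<le> 1"
  shows "exp (s * u) \<le> 1 - u + u * exp s"
  using convex_onD[OF exp_convex, of u 0 s] assms by (simp add: mult.commute)

text \<open>The entropy inequality at $\lambda = -s$ reads $(s + 2 (e^s - s - 1)) K' \le K$ for
  $K(s) = \ln \mathbb{E} e^{-sZ} \le 0$; the lemma makes $K(s) / (s - s^2)$ decreasing.\<close>

lemma lower_tail_comparison:
  fixes s :: real
  assumes "0 < s" "s < 1"
  shows "(s + 2 * (exp s - s - 1)) * (1 - 2 * s) \<le> s - s\<^sup>2"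
proof (cases "1 - 2 * s \<le> 0")
  case True
  have "0 \<le> s + 2 * (exp s - (1 + s))"
    using assms by (intro add_nonneg_nonneg mult_nonneg_nonneg) auto
  also have "exp s - (1 + s) = exp s - s - 1"
    by simp
  finally have "0 \<le> s + 2 * (exp s - s - 1)" .
  then have "(s + 2 * (exp s - s - 1)) * (1 - 2 * s) \<le> 0"
    using True by (rule mult_nonneg_nonpos)
  also have "0 \<le> s - s\<^sup>2"
    using assms by (simp add: power2_eq_square)
  finally show ?thesis .
next
  case False
  have "(s + 2 * (exp s - s - 1)) * (1 - 2 * s) \<le> (s + s\<^sup>2 + s ^ 3) * (1 - 2 * s)"
    using exp_le_cubic[of s] assms False by (intro mult_right_mono) auto
  also have "\<dots> = s - s\<^sup>2 - s ^ 3 - 2 * s ^ 4"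
    by (simp add: algebra_simps power2_eq_square power3_eq_cube power4_eq_xxxx)
  also have "\<dots> \<le> s - s\<^sup>2"
    using zero_le_power[of s 3] zero_le_power[of s 4] assms by linarith
  finally show ?thesis .
qed

text \<open>A union bound instead of complements: the events used are closed on both sides and
  overlap at the threshold.\<close>

lemma (in prob_space) prob_ge_complement:
  assumes "{x \<in> space M. Q x} \<in> events" "{x \<in> space M. R x} \<in> events"
    and "\<And>x. x \<in> space M \<Longrightarrow> Q x \<or> R x" and "prob {x \<in> space M. R x} \<le> e"
  shows "1 - e \<le> prob {x \<in> space M. Q x}"
proof -
  have "{x \<in> space M. Q x} \<union> {x \<in> space M. R x} = space M"
    using assms(3) by auto
  then have "1 = prob ({x \<in> space M. Q x} \<union> {x \<in> space M. R x})"
    by (simp add: prob_space)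
  also have "\<dots> \<le> prob {x \<in> space M. Q x} + prob {x \<in> space M. R x}"
    using assms by (intro measure_Un_le)
  finally show ?thesis using assms(4) by simp
qed

text \<open>Isolates what the tail bounds need from the product space. The factor 2 in front of
  \<open>\<rho>\<close> is the self-bounding parameter a.\<close>

locale entropic = prob_space P for P :: "'x measure" +
  fixes Z :: "'x \<Rightarrow> real" and B :: real
  assumes Z_measurable: "Z \<in> borel_measurable P"
    and B_pos: "0 < B"
    and Z_bounds: "\<And>x. x \<in> space P \<Longrightarrow> 0 \<le> Z x \<and> Z x \<le> B"
    and entropy_le: "\<And>l \<rho>. (\<And>u. 0 \<le> u \<Longrightarrow> u \<le> 1 \<Longrightarrow> exp (- l * u) - 1 + l * u \<le> \<rho> * u) \<Longrightarrow>
      l * (LINT x|P. Z x * exp (l * Z x))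
        - (LINT x|P. exp (l * Z x)) * ln (LINT x|P. exp (l * Z x))
      \<le> 2 * \<rho> * (LINT x|P. Z x * exp (l * Z x))"
begin

section \<open>The moment generating function and its differential inequality\<close>

definition mgf :: "real \<Rightarrow> real" where "mgf l = (LINT x|P. exp (l * Z x))"

definition mgf' :: "real \<Rightarrow> real" where "mgf' l = (LINT x|P. Z x * exp (l * Z x))"

definition mean :: real where "mean = (LINT x|P. Z x)"

lemma exp_bounds: "x \<in> space P \<Longrightarrow> exp (l * Z x) \<le> exp (\<bar>l\<bar> * B)"
proof -
  assume x: "x \<in> space P"
  have "l * Z x \<le> \<bar>l\<bar> * B"
    using Z_bounds[OF x] by (intro mult_mono) auto
  then show ?thesis by simp
qed

lemma integrable_mgf: "integrable P (\<lambda>x. exp (l * Z x))"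
  by (rule integrable_const_bound[where B = "exp (\<bar>l\<bar> * B)"])
    (use exp_bounds Z_measurable in auto)

lemma integrable_mgf': "integrable P (\<lambda>x. Z x * exp (l * Z x))"
proof (rule integrable_const_bound[where B = "B * exp (\<bar>l\<bar> * B)"])
  show "AE x in P. norm (Z x * exp (l * Z x)) \<le> B * exp (\<bar>l\<bar> * B)"
    using AE_space
  proof eventually_elim
    case (elim x)
    show ?case
      unfolding real_norm_def abs_mult
      using Z_bounds[OF elim] exp_bounds[OF elim, of l] by (intro mult_mono) auto
  qed
qed (use Z_measurable in measurable)

lemma integrable_Z: "integrable P Z"
  using integrable_mgf'[of 0] by simp

lemma mgf_zero: "mgf 0 = 1" and mgf'_zero: "mgf' 0 = mean"
  by (simp_all add: mgf_def mgf'_def mean_def prob_space)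

lemma mgf_pos: "0 < mgf l"
proof -
  have "exp (- (\<bar>l\<bar> * B)) \<le> mgf l"
    unfolding mgf_def
  proof (rule integral_ge_const[OF integrable_mgf])
    show "AE x in P. exp (- (\<bar>l\<bar> * B)) \<le> exp (l * Z x)"
      using AE_space
    proof eventually_elim
      case (elim x)
      have "(- l) * Z x \<le> \<bar>l\<bar> * B"
        using Z_bounds[OF elim] by (intro mult_mono) auto
      then show ?case by simp
    qed
  qed
  then show ?thesis by (rule less_le_trans[rotated]) simp
qed

lemma mgf'_nonneg: "0 \<le> mgf' l"
  unfolding mgf'_def by (rule integral_nonneg_AE) (use AE_space Z_bounds in auto)

lemma mean_nonneg: "0 \<le> mean"
  using mgf'_nonneg[of 0] mgf'_zero by simp

lemma mgf_le_one: "l \<le> 0 \<Longrightarrow> mgf l \<le> 1"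
  unfolding mgf_def
  by (rule integral_le_const[OF integrable_mgf])
    (use AE_space Z_bounds in \<open>auto intro!: mult_nonpos_nonneg\<close>)

text \<open>For |h| < 1/B the product h Z stays in [-1,1], so the second-order error is at most h^2
  times a constant depending on \<open>l\<close> and \<open>B\<close>; division by h leaves a
  multiple of |h|.\<close>

lemma mgf_deriv: "(mgf has_real_derivative mgf' l) (at l)"
proof -
  let ?C = "exp (\<bar>l\<bar> * B) * B\<^sup>2"
  have "((\<lambda>h. (mgf (l + h) - mgf l) / h - mgf' l) \<longlongrightarrow> 0) (at 0)"
  proof (rule tendsto_0_le[where K = ?C])
    show "((\<lambda>h :: real. h) \<longlongrightarrow> 0) (at 0)" by (rule tendsto_ident_at)
    have "\<forall>\<^sub>F h in at 0. h \<noteq> 0 \<and> \<bar>h\<bar> < 1 / B"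
      using B_pos by (auto simp: eventually_at intro!: exI[of _ "1 / B"])
    then show "\<forall>\<^sub>F h in at 0. norm ((mgf (l + h) - mgf l) / h - mgf' l) \<le> norm h * ?C"
    proof eventually_elim
      case (elim h)
      have eq: "mgf (l + h) - mgf l - h * mgf' l
          = (LINT x|P. exp ((l + h) * Z x) - exp (l * Z x) - h * (Z x * exp (l * Z x)))"
        unfolding mgf_def mgf'_def using integrable_mgf integrable_mgf' by simp
      have "\<bar>mgf (l + h) - mgf l - h * mgf' l\<bar> \<le> (LINT x|P. \<bar>exp ((l + h) * Z x) - exp (l * Z x) - h * (Z x * exp (l * Z x))\<bar>)"
        unfolding eq by (rule integral_abs_bound)
      also have "\<dots> \<le> h\<^sup>2 * ?C"
      proof (rule integral_le_const)
        show "AE x in P. \<bar>exp ((l + h) * Z x) - exp (l * Z x) - h * (Z x * exp (l * Z x))\<bar> \<le> h\<^sup>2 * ?C"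
          using AE_space
        proof eventually_elim
          case x: (elim x)
          have "\<bar>h * Z x\<bar> \<le> \<bar>h\<bar> * B"
            unfolding abs_mult using Z_bounds[OF x] by (intro mult_left_mono) auto
          also have "\<dots> \<le> 1" using elim B_pos by (simp add: field_simps)
          finally have "\<bar>exp (h * Z x) - 1 - h * Z x\<bar> \<le> (h * Z x)\<^sup>2"
            by (rule exp_minus_one_minus_le_square)
          also have "\<dots> \<le> h\<^sup>2 * B\<^sup>2"
            unfolding power_mult_distrib using Z_bounds[OF x] by (intro mult_left_mono power_mono) auto
          finally have le: "\<bar>exp (h * Z x) - 1 - h * Z x\<bar> \<le> h\<^sup>2 * B\<^sup>2" .
          have "exp ((l + h) * Z x) - exp (l * Z x) - h * (Z x * exp (l * Z x))
              = exp (l * Z x) * (exp (h * Z x) - 1 - h * Z x)"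
            by (simp add: exp_add distrib_right algebra_simps)
          then have "\<bar>exp ((l + h) * Z x) - exp (l * Z x) - h * (Z x * exp (l * Z x))\<bar>
              = exp (l * Z x) * \<bar>exp (h * Z x) - 1 - h * Z x\<bar>"
            by (simp add: abs_mult)
          also have "\<dots> \<le> exp (\<bar>l\<bar> * B) * (h\<^sup>2 * B\<^sup>2)"
            using le exp_bounds[OF x] by (intro mult_mono) auto
          finally show ?case by (simp add: mult_ac)
        qed
      qed (use integrable_mgf integrable_mgf' in auto)
      finally have main: "\<bar>mgf (l + h) - mgf l - h * mgf' l\<bar> \<le> h\<^sup>2 * ?C" .
      have "(mgf (l + h) - mgf l) / h - mgf' l = (mgf (l + h) - mgf l - h * mgf' l) / h"
        using elim by (simp add: field_simps)
      then have "\<bar>(mgf (l + h) - mgf l) / h - mgf' l\<bar> = \<bar>mgf (l + h) - mgf l - h * mgf' l\<bar> / \<bar>h\<bar>"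
        by simp
      also have "\<dots> \<le> h\<^sup>2 * ?C / \<bar>h\<bar>"
        using main by (intro divide_right_mono) auto
      also have "\<dots> = \<bar>h\<bar> * ?C"
        using elim by (cases "0 \<le> h") (auto simp: power2_eq_square)
      finally show ?case by simp
    qed
  qed
  then show ?thesis
    unfolding DERIV_def by (subst (asm) LIM_zero_iff)
qed

lemma ln_mgf_deriv: "((\<lambda>l. ln (mgf l)) has_real_derivative mgf' l / mgf l) (at l)"
  using mgf_pos[of l] by (auto intro!: derivative_eq_intros mgf_deriv)

lemma ln_mgf_quotient_tendsto: "((\<lambda>l. ln (mgf l) / l) \<longlongrightarrow> mean) (at 0)"
  using ln_mgf_deriv[of 0] by (simp add: DERIV_def mgf_zero mgf'_zero)

lemma mgf_upper:
  assumes "0 < l" "l < 1"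
  shows "mgf l \<le> exp (mean * l / (1 - l))"
proof -
  let ?Q = "\<lambda>l. ln (mgf l) * (1 / l - 1)"
  have deriv: "\<exists>d. (?Q has_real_derivative d) (at t) \<and> d \<le> 0" if t: "0 < t" "t < 1" for t
  proof (intro exI conjI)
    have "((\<lambda>l. 1 / l - 1) has_real_derivative - 1 / t\<^sup>2) (at t)"
      using t by (auto intro!: derivative_eq_intros simp: power2_eq_square)
    from DERIV_mult[OF ln_mgf_deriv this]
    show "(?Q has_real_derivative (mgf' t / mgf t * (1 / t - 1) + ln (mgf t) * (- 1 / t\<^sup>2))) (at t)"
      by (simp only: mult.commute)
    \<comment> \<open>The slope is t^2/2, because (t u)^2/2 \<le> (t^2/2) u on [0,1]. The result (t
      - t^2) L' \<le> L is exactly the sign of the derivative of \<open>?Q\<close>.\<close>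
    have "t * mgf' t - mgf t * ln (mgf t) \<le> 2 * (t\<^sup>2 / 2) * mgf' t"
      unfolding mgf_def mgf'_def
    proof (rule entropy_le)
      fix u :: real assume u: "0 \<le> u" "u \<le> 1"
      have "exp (- t * u) - 1 + t * u \<le> (t * u)\<^sup>2 / 2"
        using exp_minus_le_quadratic[of "t * u"] t u by simp
      also have "\<dots> \<le> t\<^sup>2 / 2 * u"
        using mult_left_mono[OF mult_left_le[OF u(2,1)], of "t\<^sup>2 / 2"]
        by (simp add: power_mult_distrib power2_eq_square mult_ac)
      finally show "exp (- t * u) - 1 + t * u \<le> t\<^sup>2 / 2 * u" .
    qed
    then have "(t - t\<^sup>2) * mgf' t - mgf t * ln (mgf t) \<le> 0"
      by (simp add: algebra_simps)
    moreover have "mgf' t / mgf t * (1 / t - 1) + ln (mgf t) * (- 1 / t\<^sup>2)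
        = ((t - t\<^sup>2) * mgf' t - mgf t * ln (mgf t)) / (t\<^sup>2 * mgf t)"
      using t mgf_pos[of t] by (simp add: field_simps power2_eq_square)
    ultimately show "mgf' t / mgf t * (1 / t - 1) + ln (mgf t) * (- 1 / t\<^sup>2) \<le> 0"
      using mgf_pos[of t] by (simp add: divide_nonpos_nonneg)
  qed
  have "?Q l \<le> mean"
  proof (rule tendsto_lowerbound)
    have "((\<lambda>t. ln (mgf t) / t * (1 - t)) \<longlongrightarrow> mean * (1 - 0)) (at_right 0)"
      by (intro tendsto_intros filterlim_mono[OF ln_mgf_quotient_tendsto order.refl at_le]) auto
    then show "((\<lambda>t. ln (mgf t) / t * (1 - t)) \<longlongrightarrow> mean) (at_right 0)" by simp
    have "\<forall>\<^sub>F t in at_right 0. t \<in> {0<..<l}"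
      using assms by (intro eventually_at_right_real)
    then show "\<forall>\<^sub>F t in at_right 0. ?Q l \<le> ln (mgf t) / t * (1 - t)"
    proof eventually_elim
      case (elim t)
      have "?Q l \<le> ?Q t"
        by (rule DERIV_nonpos_imp_nonincreasing) (use elim assms deriv in auto)
      also have "?Q t = ln (mgf t) / t * (1 - t)"
        using elim by (simp add: field_simps)
      finally show ?case .
    qed
  qed simp
  then have "ln (mgf l) \<le> mean * l / (1 - l)"
    using assms by (simp add: field_simps)
  then show ?thesis
    using mgf_pos[of l] by (metis exp_le_cancel_iff exp_ln)
qed

lemma mgf_lower:
  assumes "0 < s"
  shows "mgf (- s) \<le> exp (- mean * (s - s\<^sup>2))"
proof (cases "s < 1")
  case False
  \<comment> \<open>For s \<ge> 1 the bound is trivial, as s - s^2 \<le> 0 makes the right side at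
    least 1. This keeps the parameter of the lower tail unrestricted.\<close>
  have "mgf (- s) \<le> 1" using assms by (intro mgf_le_one) simp
  also have "s \<le> s\<^sup>2" using False by (simp add: power2_eq_square)
  then have "1 \<le> exp (- mean * (s - s\<^sup>2))"
    using mean_nonneg by (simp add: mult_nonneg_nonpos)
  finally show ?thesis .
next
  case True
  let ?K = "\<lambda>s. ln (mgf (- s))"
  let ?Q = "\<lambda>s. ?K s / (s - s\<^sup>2)"
  have r_pos: "0 < t - t\<^sup>2" if "0 < t" "t < 1" for t :: real
    using that by (simp add: power2_eq_square)
  have K_deriv: "(?K has_real_derivative - (mgf' (- t) / mgf (- t))) (at t)" for t
  proof -
    have "(uminus has_real_derivative - 1) (at t)"
      by (auto intro!: derivative_eq_intros)
    from DERIV_chain2[OF ln_mgf_deriv this] show ?thesis by simp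
  qed
  have deriv: "\<exists>d. (?Q has_real_derivative d) (at t) \<and> d \<le> 0" if t: "0 < t" "t < 1" for t
  proof (intro exI conjI)
    let ?G = "mgf' (- t) / mgf (- t)"
    let ?h = "t + 2 * (exp t - t - 1)"
    have "((\<lambda>t. t - t\<^sup>2) has_real_derivative 1 - 2 * t) (at t)"
      by (auto intro!: derivative_eq_intros)
    from DERIV_divide[OF K_deriv this] r_pos[OF t]
    show "(?Q has_real_derivative ((- ?G) * (t - t\<^sup>2) - ?K t * (1 - 2 * t)) / ((t - t\<^sup>2) * (t - t\<^sup>2))) (at t)"
      by simp
    have G: "0 \<le> ?G" using mgf'_nonneg mgf_pos[of "- t"] by simp
    have K: "?K t \<le> 0" using mgf_le_one[of "- t"] mgf_pos[of "- t"] t by simp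
    have "(- t) * mgf' (- t) - mgf (- t) * ln (mgf (- t)) \<le> 2 * (exp t - t - 1) * mgf' (- t)"
      unfolding mgf_def mgf'_def
    proof (rule entropy_le)
      fix u :: real assume u: "0 \<le> u" "u \<le> 1"
      show "exp (- (- t) * u) - 1 + - t * u \<le> (exp t - t - 1) * u"
        using exp_convex_unit[OF u, of t] by (simp add: algebra_simps)
    qed
    then have "- ?K t * mgf (- t) \<le> ?h * mgf' (- t)"
      by (simp add: algebra_simps)
    then have K_le: "- ?K t \<le> ?h * ?G"
      using mgf_pos[of "- t"] by (simp add: field_simps)
    \<comment> \<open>Sign of the numerator of the derivative of \<open>?Q\<close>, with 1 - 2 t the
      derivative of t - t^2. Beyond t = 1/2 the sign of \<open>?K\<close> decides; before it the
      entropy inequality is needed.\<close>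
    have "- ?K t * (1 - 2 * t) \<le> ?G * (t - t\<^sup>2)"
    proof (cases "1 - 2 * t \<le> 0")
      case True
      have "- ?K t * (1 - 2 * t) \<le> 0" using True K by (intro mult_nonneg_nonpos) auto
      also have "0 \<le> ?G * (t - t\<^sup>2)" using G r_pos[OF t] by (intro mult_nonneg_nonneg) auto
      finally show ?thesis .
    next
      case False
      have "- ?K t * (1 - 2 * t) \<le> ?h * ?G * (1 - 2 * t)"
        using K_le False by (intro mult_right_mono) auto
      also have "\<dots> = ?G * (?h * (1 - 2 * t))" by simp
      also have "\<dots> \<le> ?G * (t - t\<^sup>2)"
        using lower_tail_comparison[OF t] G by (rule mult_left_mono)
      finally show ?thesis .
    qed
    then show "((- ?G) * (t - t\<^sup>2) - ?K t * (1 - 2 * t)) / ((t - t\<^sup>2) * (t - t\<^sup>2)) \<le> 0"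
      using r_pos[OF t] by (intro divide_nonpos_pos) auto
  qed
  have "?Q s \<le> - mean"
  proof (rule tendsto_lowerbound)
    have "filterlim uminus (at 0) (at_right (0::real))"
      unfolding filterlim_at by (auto simp: eventually_at_filter intro!: tendsto_eq_intros)
    from filterlim_compose[OF ln_mgf_quotient_tendsto this]
    have "((\<lambda>t. (- (?K t / (- t))) / (1 - t)) \<longlongrightarrow> (- mean) / (1 - 0)) (at_right 0)"
      by (intro tendsto_intros) auto
    then show "((\<lambda>t. (- (?K t / (- t))) / (1 - t)) \<longlongrightarrow> - mean) (at_right 0)" by simp
    have "\<forall>\<^sub>F t in at_right 0. t \<in> {0<..<s}"
      using assms by (intro eventually_at_right_real)
    then show "\<forall>\<^sub>F t in at_right 0. ?Q s \<le> (- (?K t / (- t))) / (1 - t)"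
    proof eventually_elim
      case (elim t)
      have "?Q s \<le> ?Q t"
        by (rule DERIV_nonpos_imp_nonincreasing) (use elim True deriv in auto)
      also have "?Q t = (- (?K t / (- t))) / (1 - t)"
        using elim True by (simp add: divide_simps power2_eq_square algebra_simps)
      finally show ?case .
    qed
  qed simp
  then have "?K s \<le> - mean * (s - s\<^sup>2)"
    using r_pos[OF assms True] by (simp add: pos_divide_le_eq)
  then show ?thesis
    using mgf_pos[of "- s"] by (metis exp_le_cancel_iff exp_ln)
qed

section \<open>Tail bounds by Markov's inequality\<close>

lemma chernoff:
  "prob {x \<in> space P. a \<le> l * Z x} \<le> exp (- a) * mgf l"
proof -
  have "prob {x \<in> space P. exp a \<le> exp (l * Z x)} \<le> mgf l / exp a"
    unfolding mgf_def
    by (rule integral_Markov_inequality_measure[OF integrable_mgf]) auto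
  then show ?thesis by (simp add: exp_minus field_simps)
qed

lemma upper_tail:
  assumes y: "0 < y"
  shows "1 - exp (- y) \<le> prob {x \<in> space P. Z x \<le> mean + 2 * sqrt (mean * y) + y}"
proof (cases "mean = 0")
  case True
  have "AE x in P. Z x = 0"
    using integral_nonneg_eq_0_iff_AE[OF integrable_Z] True Z_bounds by (auto simp: mean_def)
  then have "AE x in P. Z x \<le> mean + 2 * sqrt (mean * y) + y"
    by eventually_elim (use True y in simp)
  then have "prob {x \<in> space P. Z x \<le> mean + 2 * sqrt (mean * y) + y} = 1"
    using Z_measurable by (subst prob_Collect_eq_1) auto
  then show ?thesis by simp
next
  case False
  then have m: "0 < mean" using mean_nonneg by simp
  \<comment> \<open>The optimal Chernoff parameter: the threshold is mean (1 + s)^2, and -l mean (1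
    + s)^2 + mean l / (1 - l) is least at l = s / (1 + s), with value -mean s^2 = -y.\<close>
  define s where "s = sqrt (y / mean)"
  define l where "l = s / (1 + s)"
  have s: "0 < s" using m y by (simp add: s_def)
  have ms: "mean * s\<^sup>2 = y" using m y by (simp add: s_def)
  have sq: "sqrt (mean * y) = mean * s"
  proof -
    have "mean * y = (mean * s)\<^sup>2"
      by (simp add: ms[symmetric] power2_eq_square)
    then show ?thesis using m s by simp
  qed
  have l: "0 < l" "l < 1" using s by (auto simp: l_def)
  let ?a = "mean + 2 * sqrt (mean * y) + y"
  have "prob {x \<in> space P. l * ?a \<le> l * Z x} \<le> exp (- (l * ?a)) * mgf l"
    by (rule chernoff)
  also have "\<dots> \<le> exp (- (l * ?a)) * exp (mean * l / (1 - l))"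
    using mgf_upper[OF l] by (intro mult_left_mono) auto
  also have "\<dots> = exp (- (l * ?a) + mean * l / (1 - l))"
    by (simp only: exp_add)
  also have "- (l * ?a) + mean * l / (1 - l) = - y"
  proof -
    have "mean * l / (1 - l) = mean * s"
      using s by (simp add: l_def field_simps)
    moreover have "l * ?a = mean * s + y"
    proof -
      have "?a = mean * (1 + s)\<^sup>2"
        unfolding sq by (simp add: ms[symmetric] algebra_simps power2_eq_square)
      also have "l * \<dots> = mean * s * (1 + s)"
        using s by (simp add: l_def field_simps power2_eq_square)
      also have "\<dots> = mean * s + y"
        by (simp add: ms[symmetric] algebra_simps power2_eq_square)
      finally show ?thesis .
    qed
    ultimately show ?thesis by simp
  qed
  finally have "prob {x \<in> space P. ?a \<le> Z x} \<le> exp (- y)"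
    using l by simp
  then show ?thesis
    using Z_measurable by (intro prob_ge_complement[where R = "\<lambda>x. ?a \<le> Z x"]) auto
qed

lemma lower_tail:
  assumes y: "0 < y"
  shows "1 - exp (- y) \<le> prob {x \<in> space P. mean - 2 * sqrt (mean * y) \<le> Z x}"
proof (cases "mean = 0")
  case True
  then have "{x \<in> space P. mean - 2 * sqrt (mean * y) \<le> Z x} = space P"
    using Z_bounds by auto
  then show ?thesis by (simp add: prob_space)
next
  case False
  then have m: "0 < mean" using mean_nonneg by simp
  \<comment> \<open>Minimises the exponent: at a parameter r it is mean r^2 - 2 sqrt(mean y) r,
    whose minimum, at r = s, is -y.\<close>
  define s where "s = sqrt (y / mean)"
  have s: "0 < s" using m y by (simp add: s_def)
  have ms: "mean * s\<^sup>2 = y" using m y by (simp add: s_def)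
  have sq: "sqrt (mean * y) = mean * s"
  proof -
    have "mean * y = (mean * s)\<^sup>2"
      by (simp add: ms[symmetric] power2_eq_square)
    then show ?thesis using m s by simp
  qed
  let ?a = "mean - 2 * sqrt (mean * y)"
  have "prob {x \<in> space P. - s * ?a \<le> - s * Z x} \<le> exp (- (- s * ?a)) * mgf (- s)"
    by (rule chernoff)
  also have "\<dots> \<le> exp (- (- s * ?a)) * exp (- mean * (s - s\<^sup>2))"
    using mgf_lower[OF s] by (intro mult_left_mono) auto
  also have "\<dots> = exp (- (- s * ?a) + - mean * (s - s\<^sup>2))"
    by (simp only: exp_add)
  also have "- (- s * ?a) + - mean * (s - s\<^sup>2) = - (mean * s\<^sup>2)"
    unfolding sq by (simp add: algebra_simps power2_eq_square)
  finally have "prob {x \<in> space P. Z x \<le> ?a} \<le> exp (- y)"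
    using s by (simp add: ms)
  then show ?thesis
    using Z_measurable by (intro prob_ge_complement[where R = "\<lambda>x. Z x \<le> ?a"]) auto
qed

end

section \<open>Concentration\<close>

text \<open>The bounds are proved on the product space for a Borel version \<open>Z\<close> of
  \<open>f\<close> and carried back along the law of \<open>X\<close>, where \<open>Z\<close> and
  \<open>f\<close> agree almost surely.\<close>

lemma self_bounding_concentration:
  fixes N :: "'v measure" and X :: "nat \<Rightarrow> 'v \<Rightarrow> 'e" and f :: "(nat \<Rightarrow> 'e) \<Rightarrow> real"
  assumes "prob_space N" and indep: "prob_space.indep_vars N (\<lambda>_. E) X {1..n}"
    and n: "1 \<le> n" and meas: "measurable_at N E n X f"
    and sb: "self_bounding (space E) n 2 0 f"
    and fB: "\<And>x. x \<in> PiE {1..n} (\<lambda>_. space E) \<Longrightarrow> f x \<le> B"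
    and y: "0 < y"
  defines "m \<equiv> LINT \<omega>|N. f (random_vector n X \<omega>)"
  shows "1 - exp (- y) \<le> \<P>(\<omega> in N. f (random_vector n X \<omega>) \<le> m + 2 * sqrt (m * y) + y)"
    and "1 - exp (- y) \<le> \<P>(\<omega> in N. m - 2 * sqrt (m * y) \<le> f (random_vector n X \<omega>))"
    and "0 \<le> m"
proof -
  interpret N: prob_space N by fact
  let ?I = "{1..n}"
  let ?X = "random_vector n X"
  let ?E = "Pi\<^sub>M ?I (\<lambda>_. E)"
  have X: "X i \<in> N \<rightarrow>\<^sub>M E" if "i \<in> ?I" for i
    using indep that by (auto simp: N.indep_vars_def2)
  have rv: "?X \<in> N \<rightarrow>\<^sub>M ?E"
    unfolding random_vector_def using X by (intro measurable_restrict) auto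
  \<comment> \<open>Outside {1..n} the law of \<open>X 1\<close> is a filler, making every factor a
    probability space.\<close>
  define M where "M i = (if i \<in> ?I then distr N E (X i) else distr N E (X 1))" for i
  have Mp: "prob_space (M i)" for i
    unfolding M_def using X n by (auto intro!: N.prob_space_distr)
  interpret product_prob_space M ?I
    by (rule product_prob_spaceI) (rule Mp)
  interpret finite_product_prob_space M ?I
    by unfold_locales simp
  let ?P = "Pi\<^sub>M ?I M"
  have P_eq: "distr N ?E ?X = ?P"
  proof -
    have "distr N ?E ?X = Pi\<^sub>M ?I (\<lambda>i. distr N E (X i))"
      unfolding random_vector_def
      using N.indep_vars_iff_distr_eq_PiM'[where I = ?I and M' = "\<lambda>_. E" and X = X] X n indep by simp
    also have "\<dots> = ?P"
      by (rule PiM_cong) (auto simp: M_def)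
    finally show ?thesis .
  qed
  have spP: "space ?P = PiE ?I (\<lambda>_. space E)"
    unfolding P_eq[symmetric] by (simp add: space_PiM)
  have rv': "?X \<in> N \<rightarrow>\<^sub>M ?P"
    using rv unfolding P_eq[symmetric] by simp
  have spM: "space (M i) = space E" if "i \<in> ?I" for i
    using that by (simp add: M_def)
  obtain F where F: "\<And>x i. x \<in> PiE ?I (\<lambda>_. space E) \<Longrightarrow> i \<in> ?I \<Longrightarrow>
      0 \<le> f x - F i (delete_coord n i x) \<and> f x - F i (delete_coord n i x) \<le> 1"
    and Fs: "\<And>x. x \<in> PiE ?I (\<lambda>_. space E) \<Longrightarrow>
      (\<Sum>i=1..n. f x - F i (delete_coord n i x)) \<le> 2 * f x"
    using sb unfolding self_bounding_def add_0_right by blast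
  have f0: "0 \<le> f x" if x: "x \<in> PiE ?I (\<lambda>_. space E)" for x
  proof -
    have "0 \<le> (\<Sum>i=1..n. f x - F i (delete_coord n i x))"
      using F[OF x] by (intro sum_nonneg) auto
    then show ?thesis using Fs[OF x] by simp
  qed
  have fm: "(\<lambda>\<omega>. f (?X \<omega>)) \<in> borel_measurable N"
    and fc: "f \<in> borel_measurable (completion ?P)"
    using meas unfolding measurable_at_def P_eq by auto
  obtain g where g: "g \<in> borel_measurable ?P" and fg: "AE x in ?P. f x = g x"
    using completion_ex_borel_measurable_real[OF fc] by blast
  define C where "C = max 1 B"
  \<comment> \<open>Truncation bounds \<open>Z\<close> everywhere and changes nothing where g = f,
    since 0 \<le> f \<le> B \<le> C on the whole space; nonnegativity of \<open>f\<close> comes from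
    the self-bounding sum with b = 0.\<close>
  define Z where "Z x = max 0 (min C (g x))" for x
  have Z: "Z \<in> borel_measurable ?P"
    unfolding Z_def using g by measurable
  have Zb: "0 \<le> Z x \<and> Z x \<le> C" for x
    by (auto simp: Z_def C_def)
  have Zf: "AE x in ?P. Z x = f x"
    using fg AE_space
  proof eventually_elim
    case (elim x)
    then show ?case using f0[of x] fB[of x] unfolding spP Z_def C_def by auto
  qed
  have AE_sp: "AE x in ?P. x \<in> PiE ?I (\<lambda>_. space E)"
    using AE_space[of ?P] unfolding spP .
  let ?F = "\<lambda>i x. F i (delete_coord n i x)"
  have inv: "invariant_in i (?F i)" for i
  proof -
    have "delete_coord n i (x(i := z)) = delete_coord n i x" for x :: "nat \<Rightarrow> 'e" and z
      by (auto simp: delete_coord_def)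
    then show ?thesis unfolding invariant_in_def by simp
  qed
  interpret ent: entropic ?P Z C
  proof unfold_locales
    show "0 < C" by (simp add: C_def)
    show "l * (LINT x|?P. Z x * exp (l * Z x))
        - (LINT x|?P. exp (l * Z x)) * ln (LINT x|?P. exp (l * Z x))
      \<le> 2 * \<rho> * (LINT x|?P. Z x * exp (l * Z x))"
      if \<rho>: "\<And>u. 0 \<le> u \<Longrightarrow> u \<le> 1 \<Longrightarrow> exp (- l * u) - 1 + l * u \<le> \<rho> * u" for l \<rho>
    proof (rule self_bounding_entropy[where B = C, OF Z _ _ inv _ _ \<rho>])
      show "AE x in ?P. \<forall>i\<in>?I. ?F i x \<le> Z x \<and> Z x \<le> ?F i x + 1"
        using Zf AE_sp by eventually_elim (use F in force)
      show "AE x in ?P. (\<Sum>i\<in>?I. Z x - ?F i x) \<le> 2 * Z x"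
        using Zf AE_sp by eventually_elim (use Fs in simp)
    qed (use Zb C_def in auto)
  qed (use Z Zb in auto)
  have ZfN: "AE \<omega> in N. Z (?X \<omega>) = f (?X \<omega>)"
    by (rule AE_distrD[OF rv]) (simp only: P_eq Zf)
  have ZN: "(\<lambda>\<omega>. Z (?X \<omega>)) \<in> borel_measurable N"
    using measurable_compose[OF rv' Z] .
  have Z_E: "Z \<in> borel_measurable ?E"
    using Z unfolding P_eq[symmetric] by simp
  have "m = (LINT \<omega>|N. Z (?X \<omega>))"
    unfolding m_def by (rule integral_cong_AE[OF fm ZN]) (use ZfN in auto)
  also have "\<dots> = (LINT x|?P. Z x)"
    unfolding P_eq[symmetric] by (rule integral_distr[OF rv Z_E, symmetric])
  finally have m_eq: "ent.mean = m"
    unfolding ent.mean_def by (rule sym)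
  have tr: "measure ?P {x \<in> space ?P. Z x \<in> S} = \<P>(\<omega> in N. f (?X \<omega>) \<in> S)"
    if S: "S \<in> sets borel" for S
  proof -
    have "{x \<in> space ?E. Z x \<in> S} \<in> sets ?E"
      using measurable_sets[OF Z_E S] by (simp add: vimage_def Int_def conj_commute)
    then have "measure (distr N ?E ?X) {x \<in> space ?E. Z x \<in> S}
        = measure N (?X -` {x \<in> space ?E. Z x \<in> S} \<inter> space N)"
      by (rule measure_distr[OF rv])
    also have "?X -` {x \<in> space ?E. Z x \<in> S} \<inter> space N = {\<omega> \<in> space N. Z (?X \<omega>) \<in> S}"
      using measurable_space[OF rv] by auto
    \<comment> \<open>\<open>Z\<close> and \<open>f\<close> agree almost surely along
      \<open>X\<close>; comparing the two events also uses that f(X) is measurable on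
      \<open>N\<close>, the first clause of \<open>measurable_at\<close>.\<close>
    also have "measure N \<dots> = \<P>(\<omega> in N. f (?X \<omega>) \<in> S)"
    proof (rule measure_eq_AE)
      show "AE \<omega> in N. (\<omega> \<in> {\<omega> \<in> space N. Z (?X \<omega>) \<in> S}) = (\<omega> \<in> {\<omega> \<in> space N. f (?X \<omega>) \<in> S})"
        using ZfN by eventually_elim simp
      show "{\<omega> \<in> space N. Z (?X \<omega>) \<in> S} \<in> sets N"
        using measurable_sets[OF ZN S] by (simp add: vimage_def Int_def conj_commute)
      show "{\<omega> \<in> space N. f (?X \<omega>) \<in> S} \<in> sets N"
        using measurable_sets[OF fm S] by (simp add: vimage_def Int_def conj_commute)
    qed
    finally show ?thesis
      unfolding P_eq[symmetric] by simp
  qed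
  show "1 - exp (- y) \<le> \<P>(\<omega> in N. f (?X \<omega>) \<le> m + 2 * sqrt (m * y) + y)"
    using ent.upper_tail[OF y] tr[of "{..m + 2 * sqrt (m * y) + y}"]
    unfolding m_eq by simp
  show "1 - exp (- y) \<le> \<P>(\<omega> in N. m - 2 * sqrt (m * y) \<le> f (?X \<omega>))"
    using ent.lower_tail[OF y] tr[of "{m - 2 * sqrt (m * y)..}"]
    unfolding m_eq by simp
  show "0 \<le> m"
    using ent.mean_nonneg unfolding m_eq .
qed

theorem theorem9:
  fixes M :: "'w measure" and \<xi> :: "nat \<Rightarrow> 'w \<Rightarrow> real" and n :: nat and \<kappa> :: real
    and E :: "'e measure" and T :: "('e \<Rightarrow> real) set"
  assumes "2 \<le> n"
    and "prob_space M"
    and "\<And>i. i \<in> {1..n} \<Longrightarrow> \<xi> i \<in> borel_measurable M"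
    and "exchangeable M n \<xi>"
    and "integrable M (\<lambda>\<omega>. \<bar>\<xi> 1 \<omega>\<bar>)"
    and "\<kappa> = (LINT \<omega>|M. \<bar>\<xi> 1 \<omega>\<bar>)"
    and "0 < \<kappa>"
    and "AE \<omega> in M. (\<Sum>i=1..n. \<xi> i \<omega>) = 0"
    and "T \<noteq> {}"
    and "\<And>t. t \<in> T \<Longrightarrow> t \<in> borel_measurable E"
    and "\<And>t y. t \<in> T \<Longrightarrow> y \<in> space E \<Longrightarrow> t y \<in> {-1..1}"
  shows "self_bounding (space E) n 2 0 (\<lambda>x. gbar M n \<xi> T x / (\<kappa> * (3 - 2 / real n))) \<and>
    (\<forall>(N :: 'v measure) (X :: nat \<Rightarrow> 'v \<Rightarrow> 'e) (x :: real).
       prob_space N \<longrightarrow>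
       prob_space.indep_vars N (\<lambda>_. E) X {1..n} \<longrightarrow>
       measurable_at N E n X (gbar M n \<xi> T) \<longrightarrow>
       0 < x \<longrightarrow>
       (let Z = (\<lambda>\<omega>. gbar M n \<xi> T (random_vector n X \<omega>));
            EZ = (LINT \<omega>|N. Z \<omega>)
        in \<P>(\<omega> in N. Z \<omega> \<le> EZ + sqrt (12 * \<kappa> * x * EZ) + 5 * \<kappa> * x) \<ge> 1 - exp (- x) \<and>
           \<P>(\<omega> in N. Z \<omega> \<ge> EZ - sqrt (12 * \<kappa> * x * EZ)) \<ge> 1 - exp (- x)))"
proof -
  interpret exchangeable_weights M n \<xi> \<kappa>
    unfolding exchangeable_weights_def exchangeable_weights_axioms_def using assms by blast
  let ?g = "gbar M n \<xi> T"
  define c where "c = \<kappa> * (3 - 2 / real n)"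
  have c: "0 < c" "c \<le> 3 * \<kappa>"
    using scale_pos \<kappa>_pos n_ge by (auto simp: c_def field_simps)
  have bd: "\<bar>t y\<bar> \<le> 1" if "t \<in> T" "y \<in> space E" for t y
    using assms(11)[OF that] by auto
  have sb: "self_bounding (space E) n 2 0 (\<lambda>x. ?g x / c)"
    unfolding c_def by (rule gbar_self_bounding[OF assms(9)]) (use bd in auto)
  have gB: "?g x / c \<le> real n * \<kappa> / c" if x: "x \<in> PiE {1..n} (\<lambda>_. space E)" for x
  proof -
    have "bounded_class n T x"
    proof
      show "\<bar>t (x i)\<bar> \<le> 1" if "t \<in> T" "i \<in> {1..n}" for t i
        using bd[OF that(1)] PiE_mem[OF x that(2)] by blast
    qed fact
    from gbar_abs_le[OF this] show ?thesis
      using c by (intro divide_right_mono) auto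
  qed
  have conc: "1 - exp (- x) \<le> \<P>(\<omega> in N. ?g (random_vector n X \<omega>)
        \<le> EZ + sqrt (12 * \<kappa> * x * EZ) + 5 * \<kappa> * x) \<and>
      1 - exp (- x) \<le> \<P>(\<omega> in N. EZ - sqrt (12 * \<kappa> * x * EZ) \<le> ?g (random_vector n X \<omega>))"
    if N: "prob_space N" and X: "prob_space.indep_vars N (\<lambda>_. E) X {1..n}"
      and meas: "measurable_at N E n X ?g" and x: "0 < x"
      and EZ: "EZ = (LINT \<omega>|N. ?g (random_vector n X \<omega>))"
    for N :: "'v measure" and X :: "nat \<Rightarrow> 'v \<Rightarrow> 'e" and x EZ :: real
  proof -
    interpret N: prob_space N by fact
    let ?Z = "\<lambda>\<omega>. ?g (random_vector n X \<omega>)"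
    have Zm: "?Z \<in> borel_measurable N"
      using meas by (simp add: measurable_at_def)
    have meas': "measurable_at N E n X (\<lambda>x. ?g x / c)"
      using meas unfolding measurable_at_def by auto
    have m: "(LINT \<omega>|N. ?Z \<omega> / c) = EZ / c"
      by (simp add: EZ)
    note conc = self_bounding_concentration[OF N X _ meas' sb gB x, unfolded m]
    have n1: "1 \<le> n" using n_ge by simp
    have EZ0: "0 \<le> EZ"
      using conc(3)[OF n1] c by (simp add: zero_le_divide_iff)
    \<comment> \<open>Undoing the normalisation: c moves under the root as c^2, leaving 4 c x EZ
      \<le> 12 \<kappa> x EZ. The linear term becomes c x \<le> 3 \<kappa> x \<le> 5 \<kappa>
      x.\<close>
    have "c * (2 * sqrt (EZ / c * x)) = sqrt (4 * c * x * EZ)"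
    proof -
      have "4 * c * x * EZ = (c * 2)\<^sup>2 * (EZ / c * x)"
        using c by (simp add: field_simps power2_eq_square)
      then show ?thesis
        using c by (simp only: real_sqrt_mult real_sqrt_abs)
    qed
    also have "\<dots> \<le> sqrt (12 * \<kappa> * x * EZ)"
      using c x EZ0 by (intro real_sqrt_le_mono mult_right_mono) auto
    finally have sq: "c * (2 * sqrt (EZ / c * x)) \<le> sqrt (12 * \<kappa> * x * EZ)" .
    have cx: "c * x \<le> 5 * \<kappa> * x"
      using c \<kappa>_pos x by (intro mult_right_mono) auto
    have "?Z \<omega> \<le> EZ + sqrt (12 * \<kappa> * x * EZ) + 5 * \<kappa> * x"
      if "?Z \<omega> / c \<le> EZ / c + 2 * sqrt (EZ / c * x) + x" for \<omega>
    proof -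
      have "?Z \<omega> \<le> c * (EZ / c + 2 * sqrt (EZ / c * x) + x)"
        using that c by (simp add: pos_divide_le_eq mult.commute)
      also have "\<dots> = EZ + c * (2 * sqrt (EZ / c * x)) + c * x"
        using c by (simp add: distrib_left)
      finally show ?thesis using sq cx by linarith
    qed
    then have "\<P>(\<omega> in N. ?Z \<omega> / c \<le> EZ / c + 2 * sqrt (EZ / c * x) + x)
        \<le> \<P>(\<omega> in N. ?Z \<omega> \<le> EZ + sqrt (12 * \<kappa> * x * EZ) + 5 * \<kappa> * x)"
      using Zm by (intro N.finite_measure_mono) auto
    moreover have "EZ - sqrt (12 * \<kappa> * x * EZ) \<le> ?Z \<omega>"
      if "EZ / c - 2 * sqrt (EZ / c * x) \<le> ?Z \<omega> / c" for \<omega>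
    proof -
      have "c * (EZ / c - 2 * sqrt (EZ / c * x)) \<le> ?Z \<omega>"
        using that c by (simp add: pos_le_divide_eq mult.commute)
      moreover have "c * (EZ / c - 2 * sqrt (EZ / c * x)) = EZ - c * (2 * sqrt (EZ / c * x))"
        using c by (simp add: right_diff_distrib)
      ultimately show ?thesis using sq by linarith
    qed
    then have "\<P>(\<omega> in N. EZ / c - 2 * sqrt (EZ / c * x) \<le> ?Z \<omega> / c)
        \<le> \<P>(\<omega> in N. EZ - sqrt (12 * \<kappa> * x * EZ) \<le> ?Z \<omega>)"
      using Zm by (intro N.finite_measure_mono) auto
    ultimately show ?thesis
      using conc(1,2)[OF n1] by linarith
  qed
  show ?thesis
    using sb conc unfolding c_def Let_def by blast
qed

end
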